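(* For $m \geq 2$, we have $$ 4m^2 - O(\log m) \leq \mathsf{D} (\{-m,\dots,m\}^2) \leq \frac{5 \pi}{2} m^2 + O(m). $$
   Context: For a subset $X$ of an abelian group, $\mathsf{D}(X)$ (the Davenport constant of $X$) is the largest length $n$ of a sequence $x_1,\dots,x_n$ of elements of $X$ with $\sum_{i=1}^n x_i=0$ and $\sum_{i\in I}x_i\neq 0$ for every non-empty proper subset $I$ of $\{1,\dots,n\}$. $\{-m,\dots,m\}$ denotes the set of integers $i$ with $-m\le i\le m$. *)

theory Defs
  imports Complex_Main "HOL-Library.Product_Plus" "HOL-Library.Extended_Real"
begin

definition minimal_zero_sum :: "'a::ab_group_add list \<Rightarrow> bool" where
  "minimal_zero_sum xs \<longleftrightarrow>
     (\<Sum>i<length xs. xs ! i) = 0 \<and>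
     (\<forall>I. I \<noteq> {} \<and> I \<subset> {..<length xs} \<longrightarrow> (\<Sum>i\<in>I. xs ! i) \<noteq> 0)"

text \<open>
  The value is an extended natural number, so that unboundedly long minimal zero-sum
  sequences give \<open>\<infinity>\<close>; a finite supremum is attained and hence is the largest length.
  The empty list counts as minimal zero-sum, so the constant is \<open>0\<close> when
  there is no non-empty sequence.
\<close>

definition davenport :: "'a::ab_group_add set \<Rightarrow> enat" where
  "davenport X = (SUP xs \<in> {xs. set xs \<subseteq> X \<and> minimal_zero_sum xs}. enat (length xs))"

end

theory Submission
  imports Defs "HOL-Computational_Algebra.Primes" "HOL-Real_Asymp.Real_Asymp"
    "HOL-Analysis.Complex_Transcendental"
begin

text \<open>
  Lower bound: a minimal zero-sum sequence on the vertices of a lattice triangle containing the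
  origin uses each vertex as often as the determinant of the other two, provided these
  three determinants are coprime, so its length is twice the area of the triangle.  Moving two of the
  vertices of \<open>(-m,-m), (m,-m), (-m,m)\<close> by \<open>1\<close> and by \<open>s\<close> along the
  sides of the square costs only \<open>s\<close>, and the least \<open>s \<ge> 2\<close> coprime to \<open>m\<close> makes the determinants coprime.
  All primes below \<open>s\<close> divide \<open>m\<close>, so \<open>s = O(log m)\<close> by Chebyshev.

  Upper bound: in any order, the \<open>n\<close> partial sums are distinct lattice points, so their
  mean squared distance from any centre is at least about \<open>n / (2\<pi>)\<close>.  It therefore suffices to find an order
  with small mean squared distance; no bound on the largest partial sum (a Steinitz
  constant) is needed.  Let \<open>I\<close> be a subset whose sum \<open>s\<close> is as long as possible.  Along \<open>s\<close> the vectors of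
  \<open>I\<close> are positive and the others negative, and across \<open>s\<close> both parts have sum zero.  Each part is
  ordered by merging its vectors pointing to the left and to the right of \<open>s\<close>, and then the two
  parts are merged so that the component along \<open>s\<close> stays small.  Every merge has a cyclic shift as a free
  parameter; averaging over the shifts makes the error terms independent, with variance
  at most \<open>1/12\<close> of the squared step size.  The resulting mean square is at most \<open>3/5\<close> of the largest
  squared norm \<open>2m\<^sup>2\<close>, which gives \<open>n \<le> 7.64 m\<^sup>2 + O(m)\<close>, and \<open>7.64 < 5\<pi>/2\<close>.
\<close>

section \<open>The lower bound\<close>

text \<open>Absorption reduces both binomials to \<open>(n - 2) choose (k - 1)\<close>, with
  denominators \<open>n - k\<close> and \<open>k\<close>; these add up to \<open>n\<close>, which
  cancels.\<close>

lemma leibniz_triangle: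
  assumes "1 \<le> k" "k < n"
  shows "1 / (real n * real ((n - 1) choose (k - 1))) + 1 / (real n * real ((n - 1) choose k))
    = 1 / (real (n - 1) * real ((n - 2) choose (k - 1)))"
proof -
  obtain j where j: "k = Suc j" using assms by (cases k) auto
  obtain i where i: "n = Suc (Suc (j + i))" using assms j
    by (metis add_Suc less_iff_Suc_add)
  let ?N = "j + i"
  have a: "Suc i * (Suc ?N choose j) = Suc ?N * (?N choose j)"
    using binomial_absorb_comp[of "Suc ?N" j] by simp
  have b: "Suc j * (Suc ?N choose Suc j) = Suc ?N * (?N choose j)"
    by (rule Suc_times_binomial)
  have pos: "?N choose j > 0" "Suc ?N choose j > 0" "Suc ?N choose Suc j > 0" by simp_all
  have a': "real (Suc ?N choose j) = real (Suc ?N) * real (?N choose j) / real (Suc i)"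
    using arg_cong[OF a, of real] by (simp add: field_simps del: binomial_Suc_Suc)
  have b': "real (Suc ?N choose Suc j) = real (Suc ?N) * real (?N choose j) / real (Suc j)"
    using arg_cong[OF b, of real] by (simp add: field_simps del: binomial_Suc_Suc)
  let ?c = "real (?N choose j)"
  have c: "?c > 0" using pos(1) by simp
  have "1 / (real (Suc (Suc ?N)) * (real (Suc ?N) * ?c / real (Suc i))) + 1 / (real (Suc (Suc ?N)) * (real (Suc ?N) * ?c / real (Suc j)))
      = (real (Suc i) + real (Suc j)) / (real (Suc (Suc ?N)) * (real (Suc ?N) * ?c))"
    by (simp add: add_divide_distrib del: of_nat_Suc)
  also have "real (Suc i) + real (Suc j) = real (Suc (Suc ?N))" by simp
  also have "\<dots> / (real (Suc (Suc ?N)) * (real (Suc ?N) * ?c)) = 1 / (real (Suc ?N) * ?c)"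
    by (simp del: of_nat_Suc)
  finally show ?thesis
    unfolding i j by (simp add: a' b' del: binomial_Suc_Suc of_nat_Suc)
qed

text \<open>
  The reciprocals of \<open>n * ((n - 1) choose (k - 1))\<close> form Leibniz's harmonic triangle, hence they are integer
  combinations of \<open>1, 1/2, \<dots>, 1/n\<close>.
\<close>

lemma leibniz_dvd_Lcm:
  assumes "1 \<le> k" "k \<le> n"
  shows "n * ((n - 1) choose (k - 1)) dvd Lcm {1..n}"
proof -
  \<comment> \<open>\<open>L\<close> is an arbitrary common multiple, since the induction on
    \<open>k\<close> passes to row \<open>n - 1\<close> while \<open>L\<close> has to stay
    fixed.\<close>
  have "\<exists>z::int. real L / (real n * real ((n - 1) choose (k - 1))) = of_int z"
    if "\<forall>i\<in>{1..n}. i dvd L" "1 \<le> k" "k \<le> n" for L :: nat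
    using that(2,1,3)
  proof (induction k arbitrary: n rule: nat_induct_at_least)
    case base
    then have "n dvd L" by auto
    then obtain c where "L = n * c" by auto
    then show ?case using base by (intro exI[of _ "int c"]) simp
  next
    case (Suc k)
    have "\<exists>z::int. real L / (real n * real ((n - 1) choose (k - 1))) = of_int z"
      using Suc by auto
    moreover have "\<exists>z::int. real L / (real (n - 1) * real ((n - 1 - 1) choose (k - 1))) = of_int z"
      using Suc by (intro Suc.IH) auto
    ultimately obtain a b :: int where
      a: "real L / (real n * real ((n - 1) choose (k - 1))) = of_int a" and
      b: "real L / (real (n - 1) * real ((n - 2) choose (k - 1))) = of_int b"
      by (auto simp: numeral_2_eq_2)
    \<comment> \<open>The triangle recurrence gives the new entry as the entry above minus its left
      neighbour.\<close>
    have "real L / (real n * real ((n - 1) choose k)) = of_int (b - a)"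
      using arg_cong[OF leibniz_triangle[of k n], of "\<lambda>x. real L * x"] a b Suc
      by (simp add: distrib_left)
    then show ?case by (intro exI[of _ "b - a"]) simp
  qed
  from this[of "Lcm {1..n}"] assms obtain z :: int
    where z: "real (Lcm {1..n}) / (real n * real ((n - 1) choose (k - 1))) = of_int z"
    by auto
  have p: "real n * real ((n - 1) choose (k - 1)) \<noteq> 0" using assms by simp
  have "real (Lcm {1..n}) = of_int z * (real n * real ((n - 1) choose (k - 1)))"
    using z unfolding nonzero_divide_eq_eq[OF p] .
  then have "(of_int (int (Lcm {1..n})) :: real) = of_int (z * int (n * ((n - 1) choose (k - 1))))"
    by simp
  then have "int (Lcm {1..n}) = z * int (n * ((n - 1) choose (k - 1)))"
    by (simp only: of_int_eq_iff)
  then have "int (n * ((n - 1) choose (k - 1))) dvd int (Lcm {1..n})" by (metis dvd_triv_right)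
  then show ?thesis by (simp only: int_dvd_int_iff)
qed

text \<open>The \<open>n\<close> numbers \<open>n * ((n - 1) choose k)\<close> all divide the lcm,
  and their mean is \<open>2 ^ (n - 1)\<close>.\<close>

lemma Lcm_ge_two_power:
  assumes "n \<ge> 1"
  shows "2 ^ (n - 1) \<le> Lcm {1..n}"
proof -
  have L: "Lcm {1..n} > 0" by (simp add: Lcm_0_iff zero_less_iff_neq_zero)
  have "n * 2 ^ (n - 1) = (\<Sum>k\<le>n - 1. n * ((n - 1) choose k))"
    by (simp add: sum_distrib_left[symmetric] choose_row_sum)
  also have "\<dots> \<le> (\<Sum>k\<le>n - 1. Lcm {1..n})"
  proof (rule sum_mono)
    fix k assume "k \<in> {..n - 1}"
    then have "n * ((n - 1) choose (Suc k - 1)) dvd Lcm {1..n}"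
      using assms by (intro leibniz_dvd_Lcm) auto
    then show "n * ((n - 1) choose k) \<le> Lcm {1..n}" using L by (simp add: dvd_imp_le)
  qed
  also have "\<dots> = n * Lcm {1..n}" using assms by simp
  finally show ?thesis using assms by simp
qed

text \<open>A prime with \<open>p\<^sup>2 > N\<close> divides the lcm at most once, and this factor
  is already supplied by \<open>m\<close>. Each smaller prime contributes its largest power not
  exceeding \<open>N\<close>.\<close>

lemma Lcm_le_if_primes_dvd:
  fixes m N :: nat
  assumes m: "m > 0" and N: "N > 0" and pr: "\<And>p. prime p \<Longrightarrow> p \<le> N \<Longrightarrow> p dvd m"
  shows "Lcm {1..N} \<le> m * N ^ card {p. prime p \<and> p\<^sup>2 \<le> N}"
proof -
  let ?P = "{p :: nat. prime p \<and> p\<^sup>2 \<le> N}"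
  have fin: "finite ?P"
  proof (rule finite_subset)
    show "?P \<subseteq> {..N}"
    proof
      fix p :: nat assume "p \<in> ?P"
      then show "p \<in> {..N}" using le_square[of p] order_trans[of p "p * p" N] by (simp add: power2_eq_square)
    qed
  qed simp
  define e where "e p = (GREATEST k. p ^ k \<le> N)" for p :: nat
    have e: "p ^ k \<le> N \<longleftrightarrow> k \<le> e p" if "prime p" for p k
    proof -
      \<comment> \<open>The exponents are bounded, so the \<open>GREATEST\<close> in
        \<open>e\<close> is attained.\<close>
      have b: "k \<le> N" if "p ^ k \<le> N" for k
        using less_exp[of k] power_mono[of 2 p k] prime_ge_2_nat[OF \<open>prime p\<close>] that by linarith
      have "p ^ e p \<le> N"
        unfolding e_def by (rule GreatestI_nat[of _ 0 N]) (use N b in auto)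
      moreover have "k \<le> e p" if "p ^ k \<le> N"
        unfolding e_def by (rule Greatest_le_nat[of _ _ N]) (use that b in auto)
      moreover have "p ^ k \<le> p ^ e p" if "k \<le> e p"
        using that prime_ge_1_nat[OF \<open>prime p\<close>] by (intro power_increasing) auto
      ultimately show ?thesis by (meson order_trans)
    qed
    let ?X = "m * (\<Prod>p\<in>?P. p ^ e p)"
    have prod0: "(\<Prod>p\<in>?P. p ^ e p) \<noteq> 0" using fin by auto
    have X0: "?X \<noteq> 0" using m prod0 by auto
    have "k dvd ?X" if k: "k \<in> {1..N}" for k
    proof (rule multiplicity_le_imp_dvd)
      show "k \<noteq> 0" using k by simp
      fix p :: nat assume p: "prime p"
      have "p ^ multiplicity p k \<le> k"
        using k by (intro dvd_imp_le multiplicity_dvd) auto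
      then have mle: "p ^ multiplicity p k \<le> N" using k by simp
      show "multiplicity p k \<le> multiplicity p ?X"
      proof (cases "p\<^sup>2 \<le> N")
        case True
        then have "p ^ e p dvd ?X" using p fin by (intro dvd_mult dvd_prodI) auto
        then have "e p \<le> multiplicity p ?X"
          using X0 p by (intro multiplicity_geI) auto
        then show ?thesis using e[OF p] mle by (meson order_trans)
      next
        case False
        then have "multiplicity p k < 2" using e[OF p] mle by (meson not_le order_trans)
        show ?thesis
        proof (cases "multiplicity p k = 0")
          case nz: False
          then have "p ^ 1 \<le> N" using e[OF p] mle by (meson le_neq_implies_less less_one not_le order_trans nat_le_linear)
          then have "p ^ 1 dvd ?X" using pr[OF p] by simp
          then have "1 \<le> multiplicity p ?X" using X0 p by (intro multiplicity_geI) auto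
          then show ?thesis using \<open>multiplicity p k < 2\<close> by linarith
        qed simp
      qed
    qed
    then have "Lcm {1..N} dvd ?X" by (rule Lcm_least)
    then have "Lcm {1..N} \<le> ?X" using X0 by (intro dvd_imp_le) auto
    also have "(\<Prod>p\<in>?P. p ^ e p) \<le> (\<Prod>p\<in>?P. N)"
      by (rule prod_mono) (use e in auto)
    finally show ?thesis by (auto simp: m)
qed

section \<open>The least number coprime to \<open>m\<close>\<close>

text \<open>The value 1 has to be excluded: with \<open>s = 1\<close> all three multiplicities of
  the construction below are divisible by \<open>2 * m - 1\<close>.\<close>

definition least_coprime :: "nat \<Rightarrow> nat" where
  "least_coprime m = (LEAST k. k \<ge> 2 \<and> coprime k m)"

lemma least_coprime:
  assumes "m \<ge> 1"
  shows "least_coprime m \<ge> 2" "coprime (least_coprime m) m" "least_coprime m \<le> m + 1"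
    "\<And>k. 2 \<le> k \<Longrightarrow> coprime k m \<Longrightarrow> least_coprime m \<le> k"
proof -
  have ex: "m + 1 \<ge> 2 \<and> coprime (m + 1) m" using assms by simp
  from LeastI[of "\<lambda>k. k \<ge> 2 \<and> coprime k m", OF ex] show "least_coprime m \<ge> 2" "coprime (least_coprime m) m"
    by (simp_all add: least_coprime_def)
  from Least_le[of "\<lambda>k. k \<ge> 2 \<and> coprime k m", OF ex] show "least_coprime m \<le> m + 1" by (simp add: least_coprime_def)
  show "least_coprime m \<le> k" if "2 \<le> k" "coprime k m" for k
    unfolding least_coprime_def using that by (intro Least_le) auto
qed

lemma prime_dvd_if_less_least_coprime:
  assumes "m \<ge> 1" "prime p" "p < least_coprime m"
  shows "p dvd m"
proof (rule ccontr)
  assume "\<not> p dvd m"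
  then have "coprime p m" using assms(2) by (simp add: prime_imp_coprime)
  from least_coprime(4)[OF assms(1) prime_ge_2_nat[OF assms(2)] this] assms(3) show False by simp
qed

text \<open>Counting all integers up to the square root is enough, because
  \<open>sqrt N * ln N\<close> is of smaller order than \<open>N\<close>.\<close>

lemma card_primes_square_le_sqrt: "real (card {p::nat. prime p \<and> p\<^sup>2 \<le> N}) \<le> sqrt (real N)"
proof -
  let ?k = "nat \<lfloor>sqrt (real N)\<rfloor>"
  have "{p::nat. prime p \<and> p\<^sup>2 \<le> N} \<subseteq> {1..?k}"
  proof
    fix p assume "p \<in> {p::nat. prime p \<and> p\<^sup>2 \<le> N}"
    then have p: "prime p" "real (p\<^sup>2) \<le> real N" by (auto simp del: of_nat_power)
    then have "real p \<le> sqrt (real N)" by (simp add: real_le_rsqrt)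
    then have "p \<le> ?k" by (simp add: le_nat_iff le_floor_iff)
    then show "p \<in> {1..?k}" using prime_ge_1_nat[OF p(1)] by simp
  qed
  then have "card {p::nat. prime p \<and> p\<^sup>2 \<le> N} \<le> card {1..?k}" by (intro card_mono) auto
  then have "card {p::nat. prime p \<and> p\<^sup>2 \<le> N} \<le> ?k" by simp
  then have "real (card {p::nat. prime p \<and> p\<^sup>2 \<le> N}) \<le> real ?k" by linarith
  also have "\<dots> \<le> sqrt (real N)" by simp
  finally show ?thesis .
qed

lemma least_coprime_le_ln:
  "\<exists>C. \<forall>m\<ge>2. real (least_coprime m) \<le> C * ln (real m)"
proof -
  \<comment> \<open>Comparing the two bounds for the lcm and using \<open>ln 2 \<ge> 1 / 2\<close>,
    the bracket will be at most \<open>ln m\<close>. The factor 4 makes the right side grow like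
    \<open>2 * N\<close>, which beats \<open>N + 1\<close>.\<close>
  have "eventually (\<lambda>N::nat. real N + 1 \<le> 4 * ((real N - 1) / 2 - sqrt (real N) * ln (real N))) at_top"
    by real_asymp
  then obtain N0 where N0: "\<And>N. N \<ge> N0 \<Longrightarrow> real N + 1 \<le> 4 * ((real N - 1) / 2 - sqrt (real N) * ln (real N))"
    by (auto simp: eventually_at_top_linorder)
  have "real (least_coprime m) \<le> (4 + (real N0 + 1) / ln 2) * ln (real m)" if m: "m \<ge> 2" for m
  proof -
    define N where "N = least_coprime m - 1"
    have s: "least_coprime m = N + 1" "N \<ge> 1" using least_coprime(1)[of m] m by (auto simp: N_def)
    have lnm: "ln (real m) \<ge> ln 2" using m by simp
    show ?thesis
    proof (cases "N \<ge> N0")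
      case True
      have "2 ^ (N - 1) \<le> m * N ^ card {p. prime p \<and> p\<^sup>2 \<le> N}"
      proof (rule order_trans[OF Lcm_ge_two_power[OF s(2)] Lcm_le_if_primes_dvd])
        show "m > 0" "N > 0" using m s(2) by simp_all
        show "p dvd m" if "prime p" "p \<le> N" for p
          using prime_dvd_if_less_least_coprime[of m p] that m s(1) by simp
      qed
      then have "real (2 ^ (N - 1)) \<le> real (m * N ^ card {p. prime p \<and> p\<^sup>2 \<le> N})"
        by linarith
      then have "ln (real (2 ^ (N - 1))) \<le> ln (real (m * N ^ card {p. prime p \<and> p\<^sup>2 \<le> N}))"
        using m s(2) by (subst ln_le_cancel_iff) auto
      then have "(real N - 1) * ln 2 \<le> ln (real m) + real (card {p. prime p \<and> p\<^sup>2 \<le> N}) * ln (real N)"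
        using m s(2) by (simp add: ln_mult ln_realpow of_nat_diff)
      also have "\<dots> \<le> ln (real m) + sqrt (real N) * ln (real N)"
        using s(2) by (intro add_left_mono mult_right_mono card_primes_square_le_sqrt) auto
      finally have "(real N - 1) * ln 2 \<le> ln (real m) + sqrt (real N) * ln (real N)" .
      moreover have "(real N - 1) * (1 / 2) \<le> (real N - 1) * ln 2"
        using s(2) exp_half_le2 ln_ge_iff[of 2 "1 / 2"] by (intro mult_left_mono) auto
      ultimately have "real N + 1 \<le> 4 * ln (real m)" using N0[OF True] by argo
      also have "\<dots> \<le> (4 + (real N0 + 1) / ln 2) * ln (real m)"
        using lnm m by (intro mult_right_mono) auto
      finally show ?thesis using s by simp
    next
      case False
      \<comment> \<open>The finitely many small \<open>N\<close> are absorbed into the constant, as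
        \<open>ln m \<ge> ln 2\<close>.\<close>
      then have "real (least_coprime m) \<le> (real N0 + 1) / ln 2 * ln 2" using s by simp
      also have "\<dots> \<le> (4 + (real N0 + 1) / ln 2) * ln (real m)"
        using lnm by (intro mult_mono) auto
      finally show ?thesis .
    qed
  qed
  then show ?thesis by blast
qed

section \<open>Zero-sum sequences on the vertices of a lattice triangle\<close>

text \<open>By Cramer's rule every linear relation among \<open>u\<close>, \<open>v\<close>,
  \<open>w\<close> is proportional to the one with coefficients \<alpha>, \<beta>, \<gamma>.
  Coprimality makes that relation primitive, so within the available multiplicities only its
  multiples by 0 and 1 occur.\<close>

lemma minimal_zero_sum_three:
  fixes u v w :: "int \<times> int" and \<alpha> \<beta> \<gamma> :: nat
  defines "xs \<equiv> replicate \<alpha> u @ replicate \<beta> v @ replicate \<gamma> w"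
  assumes \<alpha>: "int \<alpha> = fst v * snd w - snd v * fst w" and \<beta>: "int \<beta> = fst w * snd u - snd w * fst u"
    and \<gamma>: "int \<gamma> = fst u * snd v - snd u * fst v"
    and pos: "\<gamma> > 0" and cop: "gcd (gcd \<alpha> \<beta>) \<gamma> = 1"
  shows "minimal_zero_sum xs"
proof -
  have len: "length xs = \<alpha> + \<beta> + \<gamma>" by (simp add: xs_def)
  have nth: "xs ! i = (if i < \<alpha> then u else if i < \<alpha> + \<beta> then v else w)" if "i < \<alpha> + \<beta> + \<gamma>" for i
    using that by (auto simp: xs_def nth_append)
  let ?A = "{..<\<alpha>}" and ?B = "{\<alpha>..<\<alpha> + \<beta>}" and ?C = "{\<alpha> + \<beta>..<\<alpha> + \<beta> + \<gamma>}"
  have sumI: "fst (\<Sum>i\<in>I. xs ! i) = int (card (I \<inter> ?A)) * fst u + int (card (I \<inter> ?B)) * fst v + int (card (I \<inter> ?C)) * fst w"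
    "snd (\<Sum>i\<in>I. xs ! i) = int (card (I \<inter> ?A)) * snd u + int (card (I \<inter> ?B)) * snd v + int (card (I \<inter> ?C)) * snd w"
    if I: "I \<subseteq> {..<\<alpha> + \<beta> + \<gamma>}" for I
  proof -
    have fin: "finite I" using I finite_subset by blast
    have eq: "I = (I \<inter> ?A) \<union> ((I \<inter> ?B) \<union> (I \<inter> ?C))" using I by auto
    have "(\<Sum>i\<in>I. h (xs ! i)) = (\<Sum>i\<in>I \<inter> ?A. h (xs ! i)) + ((\<Sum>i\<in>I \<inter> ?B. h (xs ! i)) + (\<Sum>i\<in>I \<inter> ?C. h (xs ! i)))"
      for h :: "int \<times> int \<Rightarrow> int"
      using fin by (subst eq, subst sum.union_disjoint, simp, simp, fastforce, subst sum.union_disjoint) auto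
    moreover have "(\<Sum>i\<in>I \<inter> ?A. h (xs ! i)) = (\<Sum>i\<in>I \<inter> ?A. h u)"
      "(\<Sum>i\<in>I \<inter> ?B. h (xs ! i)) = (\<Sum>i\<in>I \<inter> ?B. h v)"
      "(\<Sum>i\<in>I \<inter> ?C. h (xs ! i)) = (\<Sum>i\<in>I \<inter> ?C. h w)" for h :: "int \<times> int \<Rightarrow> int"
      by (rule sum.cong; auto simp: nth)+
    ultimately have *: "(\<Sum>i\<in>I. h (xs ! i)) = int (card (I \<inter> ?A)) * h u + int (card (I \<inter> ?B)) * h v + int (card (I \<inter> ?C)) * h w"
      for h :: "int \<times> int \<Rightarrow> int"
      by simp
    show "fst (\<Sum>i\<in>I. xs ! i) = int (card (I \<inter> ?A)) * fst u + int (card (I \<inter> ?B)) * fst v + int (card (I \<inter> ?C)) * fst w"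
      "snd (\<Sum>i\<in>I. xs ! i) = int (card (I \<inter> ?A)) * snd u + int (card (I \<inter> ?B)) * snd v + int (card (I \<inter> ?C)) * snd w"
      using *[of fst] *[of snd] by (simp_all add: fst_sum snd_sum)
  qed
  show ?thesis
    unfolding minimal_zero_sum_def
  proof (intro conjI allI impI)
    have "{..<\<alpha> + \<beta> + \<gamma>} \<inter> ?A = ?A" "{..<\<alpha> + \<beta> + \<gamma>} \<inter> ?B = ?B" "{..<\<alpha> + \<beta> + \<gamma>} \<inter> ?C = ?C" by auto
    then show "(\<Sum>i<length xs. xs ! i) = 0"
      using sumI[of "{..<\<alpha> + \<beta> + \<gamma>}"] unfolding len
      by (intro prod_eqI) (simp_all add: \<alpha> \<beta> \<gamma> algebra_simps)
  next
    fix I assume I: "I \<noteq> {} \<and> I \<subset> {..<length xs}"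
    show "(\<Sum>i\<in>I. xs ! i) \<noteq> 0"
    proof
      assume zero: "(\<Sum>i\<in>I. xs ! i) = 0"
      have sub: "I \<subseteq> {..<\<alpha> + \<beta> + \<gamma>}" using I len by auto
      define i j k where "i = card (I \<inter> ?A)" "j = card (I \<inter> ?B)" "k = card (I \<inter> ?C)"
      have le: "i \<le> \<alpha>" "j \<le> \<beta>" "k \<le> \<gamma>"
        using card_mono[of ?A "I \<inter> ?A"] card_mono[of ?B "I \<inter> ?B"] card_mono[of ?C "I \<inter> ?C"]
        by (auto simp: i_j_k_def)
      have e: "int i * fst u + int j * fst v + int k * fst w = 0"
          "int i * snd u + int j * snd v + int k * snd w = 0"
        using sumI[OF sub] zero by (simp_all add: i_j_k_def)
      \<comment> \<open>This is the determinant of \<open>u\<close> with the vanishing sum; the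
        determinant with \<open>v\<close> gives the companion equation for \<open>i\<close>.\<close>
      have "int j * int \<gamma> = int k * int \<beta>"
        unfolding \<gamma> \<beta> using e by algebra
      then have jk: "j * \<gamma> = k * \<beta>" by (simp only: of_nat_mult[symmetric] of_nat_eq_iff)
      have "int i * int \<gamma> = int k * int \<alpha>"
        unfolding \<gamma> \<alpha> using e by algebra
      then have ik: "i * \<gamma> = k * \<alpha>" by (simp only: of_nat_mult[symmetric] of_nat_eq_iff)
      have "\<gamma> dvd gcd (k * \<alpha>) (k * \<beta>)" using jk ik by (metis dvd_triv_right gcd_greatest)
      then have "\<gamma> dvd k * gcd \<alpha> \<beta>" by (simp add: gcd_mult_distrib_nat)
      then have "\<gamma> dvd k" using cop
        by (metis coprime_commute coprime_dvd_mult_left_iff coprime_iff_gcd_eq_1)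
      then have "k = 0 \<or> k = \<gamma>" using le(3) by (metis dvd_imp_le le_antisym not_gr_zero)
      then have "(i = 0 \<and> j = 0 \<and> k = 0) \<or> (i = \<alpha> \<and> j = \<beta> \<and> k = \<gamma>)"
        using ik jk pos by auto
      moreover have "card I = i + j + k"
      proof -
        have "finite I" using sub finite_subset by blast
        then have "card ((I \<inter> ?A) \<union> ((I \<inter> ?B) \<union> (I \<inter> ?C))) = i + (j + k)"
          unfolding i_j_k_def
          by (subst card_Un_disjoint, simp, simp, fastforce, subst card_Un_disjoint) auto
        moreover have "(I \<inter> ?A) \<union> ((I \<inter> ?B) \<union> (I \<inter> ?C)) = I" using sub by auto
        ultimately show ?thesis by simp
      qed
      moreover have "card I > 0" using I sub finite_subset[OF sub] by (auto simp: card_gt_0_iff)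
      moreover have "card I < \<alpha> + \<beta> + \<gamma>" using I psubset_card_mono[of "{..<length xs}" I] len by simp
      ultimately show False by auto
    qed
  qed
qed

lemma davenport_ge:
  assumes "set xs \<subseteq> X" "minimal_zero_sum xs"
  shows "enat (length xs) \<le> davenport X"
  unfolding davenport_def using assms by (intro SUP_upper) auto

text \<open>
  A prime dividing all three multiplicities either divides both \<open>m\<close> and \<open>s\<close>, or
  divides \<open>2m - 1\<close> and \<open>s - 1\<close>; in the latter case it is smaller than \<open>s\<close> and so divides \<open>m\<close>.
\<close>

lemma davenport_box_ge:
  fixes m :: nat
  assumes m: "m \<ge> 2"
  shows "enat (4 * m\<^sup>2 - least_coprime m) \<le> davenport ({- int m..int m} \<times> {- int m..int m})"
proof -
  define s where "s = least_coprime m"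
  have s: "s \<ge> 2" "coprime s m" "s \<le> m + 1" using least_coprime[of m] m by (auto simp: s_def)
  define u v w :: "int \<times> int" where uvw: "u = (- int m, - int m)" "v = (int m, 1 - int m)" "w = (int s - int m, int m)"
  define \<alpha> where "\<alpha> = m + (m - 1) * s"
  define \<beta> where "\<beta> = m * (2 * m - s)"
  define \<gamma> where "\<gamma> = m * (2 * m - 1)"
  have c: "s \<le> 2 * m" "1 \<le> m" using s m by auto
  have i: "int \<alpha> = int m + (int m - 1) * int s" "int \<beta> = int m * (2 * int m - int s)"
      "int \<gamma> = int m * (2 * int m - 1)"
    unfolding \<alpha>_def \<beta>_def \<gamma>_def using c by (simp_all add: of_nat_diff)
  have \<alpha>: "int \<alpha> = fst v * snd w - snd v * fst w"
    and \<beta>: "int \<beta> = fst w * snd u - snd w * fst u"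
    and \<gamma>: "int \<gamma> = fst u * snd v - snd u * fst v"
    unfolding i by (simp_all add: uvw algebra_simps)
  \<comment> \<open>The total is the determinant of \<open>v - u = (2m, 1)\<close> and
    \<open>w - u = (s, 2m)\<close>.\<close>
  have "int (\<alpha> + \<beta> + \<gamma>) = 4 * (int m)\<^sup>2 - int s"
    unfolding of_nat_add \<alpha> \<beta> \<gamma> by (simp add: uvw power2_eq_square algebra_simps)
  then have tot: "\<alpha> + \<beta> + \<gamma> = 4 * m\<^sup>2 - s" by (simp flip: of_nat_power)
  have cop: "gcd (gcd \<alpha> \<beta>) \<gamma> = 1"
  proof (rule ccontr)
    assume "gcd (gcd \<alpha> \<beta>) \<gamma> \<noteq> 1"
    then obtain p where p: "prime p" "p dvd gcd (gcd \<alpha> \<beta>) \<gamma>" using prime_factor_nat by blast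
    then have d: "p dvd \<alpha>" "p dvd \<beta>" "p dvd \<gamma>" by auto
    have di: "int p dvd int m + (int m - 1) * int s"
      using d(1) by (simp flip: i int_dvd_int_iff)
    show False
    proof (cases "p dvd m")
      case True
      then have "int p dvd int m" by simp
      then have "int p dvd int m + int m * int s - (int m + (int m - 1) * int s)"
        by (intro dvd_diff[OF _ di] dvd_add dvd_mult2)
      then have "int p dvd int s" by (simp add: algebra_simps)
      then have "p dvd s" by simp
      then show False using True s(2) p(1) by (metis coprime_common_divisor not_prime_unit)
    next
      case False
      then have "p dvd 2 * m - s" "p dvd 2 * m - 1"
        using d p(1) by (auto simp: \<beta>_def \<gamma>_def prime_dvd_mult_iff)
      then have ii: "int p dvd 2 * int m - int s" "int p dvd 2 * int m - 1"
        using c by (simp_all add: of_nat_diff flip: int_dvd_int_iff)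
      have "int p dvd (2 * int m - 1) - (2 * int m - int s)" using ii by (rule dvd_diff[rotated])
      then have "int p dvd int (s - 1)" using s by (simp add: of_nat_diff)
      then have "p dvd s - 1" by simp
      then have "p \<le> s - 1" using s by (intro dvd_imp_le) auto
      then have "p dvd m" using prime_dvd_if_less_least_coprime[of m p] p s m by (auto simp: s_def)
      then show False using False by simp
    qed
  qed
  have \<gamma>0: "\<gamma> > 0" using m by (simp add: \<gamma>_def)
  let ?xs = "replicate \<alpha> u @ replicate \<beta> v @ replicate \<gamma> w"
  have "minimal_zero_sum ?xs" by (rule minimal_zero_sum_three[OF \<alpha> \<beta> \<gamma> \<gamma>0 cop])
  moreover have "set ?xs \<subseteq> {- int m..int m} \<times> {- int m..int m}"
    using s m by (auto simp: uvw)
  ultimately have "enat (length ?xs) \<le> davenport ({- int m..int m} \<times> {- int m..int m})"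
    by (intro davenport_ge)
  moreover have "length ?xs = 4 * m\<^sup>2 - s" using tot by simp
  ultimately show ?thesis by (simp add: s_def)
qed

section \<open>Merging orders\<close>

text \<open>
  An order of a finite set is an injective key \<open>\<kappa>\<close>.  An element of weight \<open>w\<close> occupies \<open>4w\<close> units of
  time and is used at the middle of its interval.  Hence elements are used at even times, and the
  states of an order are observed at odd times, so that no ties occur between an order
  and an oddly shifted one.
\<close>

definition before :: "'a set \<Rightarrow> ('a \<Rightarrow> nat) \<Rightarrow> 'a \<Rightarrow> 'a set" where
  "before S \<kappa> v = {u \<in> S. \<kappa> u < \<kappa> v}"

definition pos :: "'a set \<Rightarrow> ('a \<Rightarrow> nat) \<Rightarrow> ('a \<Rightarrow> nat) \<Rightarrow> 'a \<Rightarrow> nat" where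
  "pos S \<kappa> w v = 4 * sum w (before S \<kappa> v) + 2 * w v"

definition used :: "'a set \<Rightarrow> ('a \<Rightarrow> nat) \<Rightarrow> ('a \<Rightarrow> nat) \<Rightarrow> nat \<Rightarrow> 'a set" where
  "used S \<kappa> w t = {u \<in> S. pos S \<kappa> w u < t}"

lemma finite_before [simp]: "finite S \<Longrightarrow> finite (before S \<kappa> v)"
  by (simp add: before_def)

lemma finite_used [simp]: "finite S \<Longrightarrow> finite (used S \<kappa> w t)"
  by (simp add: used_def)

lemma before_subset: "before S \<kappa> v \<subseteq> S"
  by (auto simp: before_def)

lemma not_in_before [simp]: "v \<notin> before S \<kappa> v"
  by (simp add: before_def)

lemma even_pos [simp]: "even (pos S \<kappa> w v)"
  by (simp add: pos_def)

text \<open>The time intervals of \<open>u\<close> and \<open>v\<close> do not overlap, so their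
  midpoints differ by at least the two half-lengths.\<close>

lemma pos_less:
  assumes "finite S" "u \<in> S" "\<kappa> u < \<kappa> v"
  shows "pos S \<kappa> w u + 2 * w u + 2 * w v \<le> pos S \<kappa> w v"
proof -
  have "sum w (insert u (before S \<kappa> u)) \<le> sum w (before S \<kappa> v)"
    by (rule sum_mono2) (use assms in \<open>auto simp: before_def\<close>)
  then show ?thesis using assms by (simp add: pos_def)
qed

lemma pos_le:
  assumes "finite S" "v \<in> S"
  shows "pos S \<kappa> w v + 2 * w v \<le> 4 * sum w S"
proof -
  have "sum w (insert v (before S \<kappa> v)) \<le> sum w S"
    by (rule sum_mono2) (use assms in \<open>auto simp: before_def\<close>)
  then show ?thesis using assms by (simp add: pos_def)
qed

lemma key_less_if_pos_less:
  assumes "finite S" "v \<in> S" "u \<in> S" "inj_on \<kappa> S" "pos S \<kappa> w u < pos S \<kappa> w v"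
  shows "\<kappa> u < \<kappa> v"
proof (rule ccontr)
  assume "\<not> \<kappa> u < \<kappa> v"
  moreover have "\<kappa> u \<noteq> \<kappa> v" using assms by (auto dest: inj_onD)
  ultimately have "\<kappa> v < \<kappa> u" by simp
  from pos_less[OF assms(1,2) this, of w] assms(5) show False by simp
qed

lemma sum_lessThan_add:
  fixes F :: "nat \<Rightarrow> real"
  shows "(\<Sum>k<a + b. F k) = (\<Sum>k<a. F k) + (\<Sum>j<b. F (a + j))"
  by (induction b) (simp_all add: add.assoc)

text \<open>The interval of \<open>v\<close> contains \<open>2 * w v\<close> odd times. In the first
  half of them \<open>v\<close> has not been used yet, in the second half it has.\<close>

lemma sum_observations:
  fixes h :: "nat \<Rightarrow> 'a set \<Rightarrow> real"
  assumes "finite S" "inj_on \<kappa> S"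
  shows "(\<Sum>k<2 * sum w S. h (2 * k + 1) (used S \<kappa> w (2 * k + 1))) =
    (\<Sum>v\<in>S. (\<Sum>j<w v. h (4 * sum w (before S \<kappa> v) + 2 * j + 1) (before S \<kappa> v)) +
      (\<Sum>j<w v. h (4 * sum w (before S \<kappa> v) + 2 * w v + 2 * j + 1) (insert v (before S \<kappa> v))))"
  using assms
\<comment> \<open>Elements are added in increasing key order, so the new interval is appended at the
  end and earlier states stay unchanged.\<close>
proof (induction S rule: finite_ranking_induct[where f = \<kappa>])
  case empty
  then show ?case by simp
next
  case (insert z S)
  show ?case
  proof (cases "z \<in> S")
    case True
    then show ?thesis using insert by (simp add: insert_absorb)
  next
    case False
    have inj: "inj_on \<kappa> S" using insert.prems by (auto intro: inj_on_subset)
    have less: "\<kappa> y < \<kappa> z" if "y \<in> S" for y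
    proof -
      have "\<kappa> y \<noteq> \<kappa> z" using insert.prems that False by (auto simp: inj_on_def)
      then show ?thesis using insert.hyps(2)[OF that] by simp
    qed
    have bS: "before (insert z S) \<kappa> v = before S \<kappa> v" if "v \<in> S" for v
      using less[OF that] by (auto simp: before_def)
    have bz: "before (insert z S) \<kappa> z = S"
      using less by (auto simp: before_def)
    let ?W = "sum w S"
    have pS: "pos (insert z S) \<kappa> w v = pos S \<kappa> w v" if "v \<in> S" for v
      using bS[OF that] by (simp add: pos_def)
    have pz: "pos (insert z S) \<kappa> w z = 4 * ?W + 2 * w z"
      using bz by (simp add: pos_def)
    have u1: "used (insert z S) \<kappa> w t = used S \<kappa> w t" if "t < 4 * ?W" for t
      using pS pz that by (auto simp: used_def)
    have pSle: "pos S \<kappa> w v \<le> 4 * ?W" if "v \<in> S" for v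
      using pos_le[OF insert.hyps(1) that, of \<kappa> w] by simp
    have u2: "used (insert z S) \<kappa> w (4 * ?W + 2 * j + 1) = S" if "j < w z" for j
      using pS pz that pSle False by (fastforce simp: used_def)
    have u3: "used (insert z S) \<kappa> w (4 * ?W + 2 * w z + 2 * j + 1) = insert z S" for j
      using pS pz pSle False by (fastforce simp: used_def)
    have split: "(\<Sum>k<2 * (a + b). F k) = (\<Sum>k<2 * a. F k) + (\<Sum>j<b. F (2 * a + j)) + (\<Sum>j<b. F (2 * a + b + j))"
      for a b and F :: "nat \<Rightarrow> real"
    proof -
      have "2 * (a + b) = (2 * a + b) + b" by simp
      then show ?thesis by (simp only: sum_lessThan_add)
    qed
    have "(\<Sum>k<2 * sum w (insert z S). h (2 * k + 1) (used (insert z S) \<kappa> w (2 * k + 1)))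
      = (\<Sum>k<2 * ?W. h (2 * k + 1) (used (insert z S) \<kappa> w (2 * k + 1)))
        + (\<Sum>j<w z. h (2 * (2 * ?W + j) + 1) (used (insert z S) \<kappa> w (2 * (2 * ?W + j) + 1)))
        + (\<Sum>j<w z. h (2 * (2 * ?W + w z + j) + 1) (used (insert z S) \<kappa> w (2 * (2 * ?W + w z + j) + 1)))"
      using insert.hyps(1) False by (simp only: sum.insert add.commute[of "w z"] split not_False_eq_True)
    also have "(\<Sum>k<2 * ?W. h (2 * k + 1) (used (insert z S) \<kappa> w (2 * k + 1)))
       = (\<Sum>k<2 * ?W. h (2 * k + 1) (used S \<kappa> w (2 * k + 1)))"
      by (rule sum.cong) (auto simp: u1)
    also have "(\<Sum>j<w z. h (2 * (2 * ?W + j) + 1) (used (insert z S) \<kappa> w (2 * (2 * ?W + j) + 1)))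
       = (\<Sum>j<w z. h (4 * ?W + 2 * j + 1) S)"
      by (rule sum.cong) (use u2 in \<open>auto simp: algebra_simps\<close>)
    also have "(\<Sum>j<w z. h (2 * (2 * ?W + w z + j) + 1) (used (insert z S) \<kappa> w (2 * (2 * ?W + w z + j) + 1)))
       = (\<Sum>j<w z. h (4 * ?W + 2 * w z + 2 * j + 1) (insert z S))"
      by (rule sum.cong) (use u3 in \<open>auto simp: algebra_simps\<close>)
    finally show ?thesis
      using insert.IH[OF inj] insert.hyps(1) False
      by (simp add: bS bz cong: sum.cong)
  qed
qed

text \<open>
  The excess of the labels used until time \<open>t\<close> over a consumption at constant speed.  With \<open>W\<close> the total
  weight, it vanishes after the final time \<open>4W\<close>, so times may be taken modulo \<open>4W\<close>.
\<close>

definition deviation :: "'a set \<Rightarrow> ('a \<Rightarrow> nat) \<Rightarrow> ('a \<Rightarrow> nat) \<Rightarrow> ('a \<Rightarrow> real) \<Rightarrow> nat \<Rightarrow> real" where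
  "deviation S \<kappa> w \<phi> t = sum \<phi> (used S \<kappa> w t) - real t / (4 * real (sum w S)) * sum \<phi> S"

text \<open>
  \<open>K\<close> merges \<open>X\<close> with \<open>Y\<close> after rotating \<open>Y\<close> cyclically by \<open>r\<close>.  Up to a constant, the partial sum before \<open>v\<close> is
  the sum of a term that does not depend on \<open>r\<close> and of the deviation of the other order at a time that runs
  through all odd residues when \<open>r\<close> does.
\<close>

lemma merge_orders:
  fixes X Y :: "'a set" and w :: "'a \<Rightarrow> nat"
  assumes fin: "finite X" "finite Y" and disj: "X \<inter> Y = {}"
    and inj: "inj_on \<kappa> X" "inj_on \<kappa> Y"
    and WX: "sum w X = W" and WY: "sum w Y = W" and W: "W > 0"
    and r: "odd r" "r < 4 * W"
  obtains K where "inj_on K (X \<union> Y)"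
    "\<And>\<phi>. sum \<phi> (X \<union> Y) = (0::real) \<Longrightarrow>
       \<exists>c. (\<forall>v\<in>X. sum \<phi> (before (X \<union> Y) K v) - c =
              sum \<phi> (before X \<kappa> v) - real (pos X \<kappa> w v) / (4 * real W) * sum \<phi> X
              + deviation Y \<kappa> w \<phi> ((r + pos X \<kappa> w v) mod (4 * W))) \<and>
           (\<forall>v\<in>Y. sum \<phi> (before (X \<union> Y) K v) - c =
              sum \<phi> (before Y \<kappa> v) - real (pos Y \<kappa> w v) / (4 * real W) * sum \<phi> Y
              + deviation X \<kappa> w \<phi> ((pos Y \<kappa> w v + 4 * W - r) mod (4 * W)))"
proof -
  define N where "N = Suc (Max (insert 0 (\<kappa> ` (X \<union> Y))))"
  have N: "\<kappa> v < N" if "v \<in> X \<union> Y" for v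
    using that fin by (auto simp: N_def less_Suc_eq_le)
  let ?pX = "pos X \<kappa> w" and ?pY = "pos Y \<kappa> w"
  \<comment> \<open>The time of use in the merged order: \<open>Y\<close> is entered at its time
    \<open>r\<close>, and what lies before \<open>r\<close> is postponed by a full period
    \<open>4 * W\<close>.\<close>
  define tm where "tm v = (if v \<in> X then ?pX v else if r < ?pY v then ?pY v - r else ?pY v + 4 * W - r)" for v
  \<comment> \<open>Equal times occur only among elements of weight 0. They are resolved by key; the
    offset \<open>N\<close> matters when an element at position 0, postponed, meets one at position
    \<open>4 * W\<close>.\<close>
  define b where "b v = \<kappa> v + (if v \<in> X \<or> r < ?pY v then 0 else N)" for v
  define K where "K v = 2 * N * tm v + b v" for v
  have b: "b v < 2 * N" if "v \<in> X \<union> Y" for v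
    using N[OF that] by (simp add: b_def)
  have less: "K u < K v \<longleftrightarrow> tm u < tm v \<or> (tm u = tm v \<and> b u < b v)" if "u \<in> X \<union> Y" "v \<in> X \<union> Y" for u v
  proof -
    have *: "K u < K v" if "tm u < tm v" "u \<in> X \<union> Y" for u v
    proof -
      have "K u < 2 * N * (tm u + 1)" using b[OF that(2)] by (simp add: K_def)
      also have "\<dots> \<le> 2 * N * tm v" using that(1) by (intro mult_left_mono) auto
      finally show ?thesis by (simp add: K_def)
    qed
    from *[of u v] *[of v u] that show ?thesis
      by (cases "tm u" "tm v" rule: linorder_cases) (auto simp: K_def)
  qed
  have leX: "?pX v \<le> 4 * W" if "v \<in> X" for v using pos_le[OF fin(1) that, of \<kappa> w] WX by simp
  have leY: "?pY v \<le> 4 * W" if "v \<in> Y" for v using pos_le[OF fin(2) that, of \<kappa> w] WY by simp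
  have monoX: "?pX u \<le> ?pX v" if "u \<in> X" "\<kappa> u < \<kappa> v" for u v
    using pos_less[OF fin(1) that, of w] by simp
  have monoY: "?pY u \<le> ?pY v" if "u \<in> Y" "\<kappa> u < \<kappa> v" for u v
    using pos_less[OF fin(2) that, of w] by simp
  have ner: "?pY v \<noteq> r" for v using r(1) even_pos[of Y \<kappa> w v] by metis
  have rY: "?pY v < r \<longleftrightarrow> \<not> r < ?pY v" for v using ner[of v] by auto
  have notX: "v \<notin> X" if "v \<in> Y" for v using disj that by auto
  have oddY: "odd (tm v)" if "v \<in> Y" for v
    using notX[OF that] ner[of v] r by (auto simp: tm_def)
  have evenX: "even (tm v)" if "v \<in> X" for v using that by (simp add: tm_def)
  have XX: "K u < K v \<longleftrightarrow> \<kappa> u < \<kappa> v" if "u \<in> X" "v \<in> X" for u v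
  proof -
    have "K u < K v \<longleftrightarrow> ?pX u < ?pX v \<or> (?pX u = ?pX v \<and> \<kappa> u < \<kappa> v)"
      using that less[of u v] by (simp add: tm_def b_def)
    then show ?thesis
      using monoX[OF that(1), of v] key_less_if_pos_less[OF fin(1) that(2,1) inj(1), of w] by force
  qed
  have YY: "K u < K v \<longleftrightarrow> (if r < ?pY v then r < ?pY u \<and> \<kappa> u < \<kappa> v else r < ?pY u \<or> \<kappa> u < \<kappa> v)"
    if "u \<in> Y" "v \<in> Y" for u v
  proof -
    have "K u < K v \<longleftrightarrow> tm u < tm v \<or> (tm u = tm v \<and> b u < b v)"
      using that less[of u v] by simp
    moreover have "\<kappa> u < N" "\<kappa> v < N" using N that by auto
    ultimately show ?thesis
      using notX[OF that(1)] notX[OF that(2)] monoY[OF that(1), of v]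
        monoY[OF that(2), of u]
        key_less_if_pos_less[OF fin(2) that(2,1) inj(2), of w] key_less_if_pos_less[OF fin(2) that inj(2), of w]
        leY[OF that(1)] leY[OF that(2)] ner[of u] ner[of v] r(2)
      by (auto simp: tm_def b_def split: if_splits)
  qed
  have YX: "K u < K v \<longleftrightarrow> tm u < ?pX v" if "u \<in> Y" "v \<in> X" for u v
  proof -
    have "tm u \<noteq> tm v" using oddY[OF that(1)] evenX[OF that(2)] by metis
    then show ?thesis using that less[of u v] by (simp add: tm_def)
  qed
  have XY: "K u < K v \<longleftrightarrow> ?pX u < tm v" if "u \<in> X" "v \<in> Y" for u v
  proof -
    have "tm u \<noteq> tm v" using evenX[OF that(1)] oddY[OF that(2)] by metis
    then show ?thesis using that less[of u v] by (simp add: tm_def)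
  qed
  have injK: "inj_on K (X \<union> Y)"
  proof (rule inj_onI)
    fix u v assume uv: "u \<in> X \<union> Y" "v \<in> X \<union> Y" "K u = K v"
    then have t: "tm u = tm v" "b u = b v" using less[of u v] less[of v u] by auto
    then have "u \<in> X \<and> v \<in> X \<or> u \<in> Y \<and> v \<in> Y" using uv(1,2) oddY[of u] oddY[of v] evenX[of u] evenX[of v] by auto
    then show "u = v"
    proof
      assume a: "u \<in> X \<and> v \<in> X"
      then show ?thesis using t(2) inj(1) by (auto simp: b_def dest: inj_onD)
    next
      assume a: "u \<in> Y \<and> v \<in> Y"
      then have "\<kappa> u < N" "\<kappa> v < N" using N by auto
      then have "\<kappa> u = \<kappa> v" using t(2) a notX by (auto simp: b_def split: if_splits)
      then show ?thesis using a inj(2) by (auto dest: inj_onD)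
    qed
  qed
  have Wr: "real W > 0" using W by simp
  show thesis
  proof (rule that[OF injK])
    fix \<phi> :: "'a \<Rightarrow> real" assume zero: "sum \<phi> (X \<union> Y) = 0"
    have SXY: "sum \<phi> X = - sum \<phi> Y" using zero fin disj by (simp add: sum.union_disjoint)
    let ?st = "\<lambda>t. sum \<phi> (used Y \<kappa> w t)"
    \<comment> \<open>The rotated \<open>Y\<close> starts from its state at time \<open>r\<close>;
      the deviation there is the constant offset.\<close>
    define c where "c = - deviation Y \<kappa> w \<phi> r"
    have "sum \<phi> (before (X \<union> Y) K v) - c =
              sum \<phi> (before X \<kappa> v) - real (?pX v) / (4 * real W) * sum \<phi> X
              + deviation Y \<kappa> w \<phi> ((r + ?pX v) mod (4 * W))" if v: "v \<in> X" for v
    proof -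
      have eq: "before (X \<union> Y) K v = before X \<kappa> v \<union> {u \<in> Y. tm u < ?pX v}"
        using XX[OF _ v] YX[OF _ v] by (auto simp: before_def)
      have d: "before X \<kappa> v \<inter> {u \<in> Y. tm u < ?pX v} = {}" using disj before_subset[of X \<kappa> v] by auto
      \<comment> \<open>The part of \<open>Y\<close> used so far is the time window from
        \<open>r\<close> to \<open>r + pos v\<close>, which either fits into one period or wraps
        around its end.\<close>
      have "sum \<phi> {u \<in> Y. tm u < ?pX v} = (if r + ?pX v < 4 * W then ?st (r + ?pX v) - ?st r
           else sum \<phi> Y - ?st r + ?st (r + ?pX v - 4 * W))"
      proof (cases "r + ?pX v < 4 * W")
        case True
        have "{u \<in> Y. tm u < ?pX v} = used Y \<kappa> w (r + ?pX v) - used Y \<kappa> w r"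
          using True notX leY ner by (auto simp: tm_def used_def split: if_splits)
        then show ?thesis using True fin by (simp add: sum_diff used_def Collect_mono_iff)
      next
        case False
        have "r + ?pX v \<noteq> 4 * W" using r(1) by (metis even_mult_iff even_numeral even_pos odd_add)
        with False have F: "r + ?pX v > 4 * W" by simp
        have eq2: "{u \<in> Y. tm u < ?pX v} = (Y - used Y \<kappa> w r) \<union> used Y \<kappa> w (r + ?pX v - 4 * W)"
          using F notX leY ner leX[OF v] r by (fastforce simp: tm_def used_def split: if_splits)
        have d2: "(Y - used Y \<kappa> w r) \<inter> used Y \<kappa> w (r + ?pX v - 4 * W) = {}"
          using leX[OF v] F by (auto simp: used_def)
        show ?thesis using F fin unfolding eq2
          by (subst sum.union_disjoint[OF _ _ d2]) (auto simp: sum_diff used_def)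
      qed
      moreover have "(r + ?pX v) mod (4 * W) = (if r + ?pX v < 4 * W then r + ?pX v else r + ?pX v - 4 * W)"
        using leX[OF v] r(2) by (simp add: le_mod_geq)
      moreover have "real (r + ?pX v - 4 * W) = real r + real (?pX v) - 4 * real W" if "\<not> r + ?pX v < 4 * W"
        using that by (simp add: of_nat_diff)
      ultimately show ?thesis using d fin Wr unfolding eq deviation_def c_def WY
        by (subst sum.union_disjoint) (auto simp: SXY field_simps)
    qed
    moreover have "sum \<phi> (before (X \<union> Y) K v) - c =
              sum \<phi> (before Y \<kappa> v) - real (?pY v) / (4 * real W) * sum \<phi> Y
              + deviation X \<kappa> w \<phi> ((?pY v + 4 * W - r) mod (4 * W))" if v: "v \<in> Y" for v
    proof -
      have t: "tm v = (?pY v + 4 * W - r) mod (4 * W)"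
        using notX[OF v] ner[of v] leY[OF v] r(2) odd_pos[OF r(1)] by (auto simp: tm_def le_mod_geq)
      have eq: "before (X \<union> Y) K v = used X \<kappa> w (tm v) \<union> {u \<in> Y. K u < K v}"
        using XY[OF _ v] by (auto simp: before_def used_def)
      have d: "used X \<kappa> w (tm v) \<inter> {u \<in> Y. K u < K v} = {}" using disj by (auto simp: used_def)
      have "sum \<phi> {u \<in> Y. K u < K v} = (if r < ?pY v then sum \<phi> (before Y \<kappa> v) - ?st r
           else sum \<phi> Y - ?st r + sum \<phi> (before Y \<kappa> v))"
      proof (cases "r < ?pY v")
        case True
        have "used Y \<kappa> w r \<subseteq> before Y \<kappa> v"
          using key_less_if_pos_less[OF fin(2) v _ inj(2), of _ w] True by (fastforce simp: before_def used_def)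
        moreover have "{u \<in> Y. K u < K v} = before Y \<kappa> v - used Y \<kappa> w r"
          using YY[OF _ v] True by (auto simp: before_def used_def rY)
        ultimately show ?thesis using True fin by (simp add: sum_diff)
      next
        case False
        have "{u \<in> Y. K u < K v} = (Y - used Y \<kappa> w r) \<union> before Y \<kappa> v"
          using YY[OF _ v] False by (auto simp: before_def used_def rY)
        moreover have "(Y - used Y \<kappa> w r) \<inter> before Y \<kappa> v = {}"
          using monoY[of _ v] False ner[of v] by (fastforce simp: before_def used_def)
        moreover have "used Y \<kappa> w r \<subseteq> Y" by (auto simp: used_def)
        ultimately show ?thesis using False fin
          by (simp add: sum.union_disjoint sum_diff)
      qed
      moreover have "real (tm v) = (if r < ?pY v then real (?pY v) - real r else real (?pY v) + 4 * real W - real r)"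
        using notX[OF v] r(2) by (auto simp: tm_def of_nat_diff)
      ultimately show ?thesis using d fin Wr unfolding eq deviation_def c_def WY WX t[symmetric]
        by (subst sum.union_disjoint) (auto simp: SXY field_simps)
    qed
    ultimately show "\<exists>c. (\<forall>v\<in>X. sum \<phi> (before (X \<union> Y) K v) - c =
              sum \<phi> (before X \<kappa> v) - real (pos X \<kappa> w v) / (4 * real W) * sum \<phi> X
              + deviation Y \<kappa> w \<phi> ((r + pos X \<kappa> w v) mod (4 * W))) \<and>
           (\<forall>v\<in>Y. sum \<phi> (before (X \<union> Y) K v) - c =
              sum \<phi> (before Y \<kappa> v) - real (pos Y \<kappa> w v) / (4 * real W) * sum \<phi> Y
              + deviation X \<kappa> w \<phi> ((pos Y \<kappa> w v + 4 * W - r) mod (4 * W)))" by blast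
  qed
qed

section \<open>Averaging over the shifts\<close>

lemma sum_shift_mod:
  fixes h :: "nat \<Rightarrow> real"
  shows "(\<Sum>k<n. h ((k + a) mod n)) = (\<Sum>k<n. h k)"
proof (induction a)
  case (Suc a)
  have "(\<Sum>k<n. h ((k + Suc a) mod n)) = (\<Sum>k<n. h ((Suc k + a) mod n))" by simp
  also have "\<dots> = (\<Sum>k<Suc n. h ((k + a) mod n)) - h (a mod n)"
    by (subst sum.lessThan_Suc_shift) simp
  also have "\<dots> = (\<Sum>k<n. h ((k + a) mod n))" by simp
  finally show ?case using Suc by simp
qed simp

lemma odd_mod: "(2 * k + 1) mod (4 * W) = 2 * (k mod (2 * W)) + 1" for k W :: nat
proof -
  have "(2 * k + 1) mod (2 * (2 * W)) = 2 * ((2 * k + 1) div 2 mod (2 * W)) + (2 * k + 1) mod 2"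
    by (rule mod_mult2_eq)
  then show ?thesis by simp
qed

text \<open>Averaging over the odd shifts thus becomes averaging over the observation times,
  whatever the even position \<open>x\<close> of the observing element.\<close>

lemma sum_times_shift:
  fixes h :: "nat \<Rightarrow> real"
  assumes "even x"
  shows "(\<Sum>k<2 * W. h ((2 * k + 1 + x) mod (4 * W))) = (\<Sum>k<2 * W. h (2 * k + 1))"
proof -
  have "(2 * k + 1 + x) mod (4 * W) = 2 * ((k + x div 2) mod (2 * W)) + 1" for k
    using odd_mod[of "k + x div 2" W] assms by simp
  then show ?thesis using sum_shift_mod[of "\<lambda>k. h (2 * k + 1)" "x div 2" "2 * W"] by simp
qed

text \<open>The counterpart for elements of the rotated set, for which the shift enters the
  observation time with a minus sign.\<close>

lemma sum_times_reflect:
  fixes h :: "nat \<Rightarrow> real"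
  assumes "even x"
  shows "(\<Sum>k<2 * W. h ((x + 4 * W - (2 * k + 1)) mod (4 * W))) = (\<Sum>k<2 * W. h (2 * k + 1))"
proof -
  have "(x + 4 * W - (2 * k + 1)) mod (4 * W) = 2 * ((2 * W - Suc k + x div 2) mod (2 * W)) + 1"
    if "k < 2 * W" for k
  proof -
    have "x + 4 * W - (2 * k + 1) = 2 * (2 * W - Suc k + x div 2) + 1"
      using that assms by (auto elim!: evenE)
    then show ?thesis by (simp only: odd_mod)
  qed
  then have "(\<Sum>k<2 * W. h ((x + 4 * W - (2 * k + 1)) mod (4 * W)))
      = (\<Sum>k<2 * W. h (2 * ((2 * W - Suc k + x div 2) mod (2 * W)) + 1))"
    by (intro sum.cong) auto
  also have "\<dots> = (\<Sum>k<2 * W. h (2 * ((k + x div 2) mod (2 * W)) + 1))"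
    by (rule sum.nat_diff_reindex[of "\<lambda>k. h (2 * ((k + x div 2) mod (2 * W)) + 1)"])
  finally show ?thesis using sum_shift_mod[of "\<lambda>k. h (2 * k + 1)" "x div 2" "2 * W"] by simp
qed

lemma before_cong: "(\<And>u. u \<in> S \<Longrightarrow> \<kappa> u = \<kappa>' u) \<Longrightarrow> v \<in> S \<Longrightarrow> before S \<kappa> v = before S \<kappa>' v"
  by (auto simp: before_def)

lemma pos_cong: "(\<And>u. u \<in> S \<Longrightarrow> \<kappa> u = \<kappa>' u) \<Longrightarrow> v \<in> S \<Longrightarrow> pos S \<kappa> w v = pos S \<kappa>' w v"
  by (simp add: pos_def before_cong[of S \<kappa> \<kappa>'])

lemma used_cong: "(\<And>u. u \<in> S \<Longrightarrow> \<kappa> u = \<kappa>' u) \<Longrightarrow> used S \<kappa> w t = used S \<kappa>' w t"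
  using pos_cong[of S \<kappa> \<kappa>'] by (auto simp: used_def)

lemma deviation_cong:
  "(\<And>u. u \<in> S \<Longrightarrow> \<kappa> u = \<kappa>' u) \<Longrightarrow> deviation S \<kappa> w \<phi> t = deviation S \<kappa>' w \<phi> t"
  by (simp add: deviation_def used_cong[of S \<kappa> \<kappa>'])

lemma sum_odd_squares_le: "(\<Sum>j<n. (2 * real j + 1)\<^sup>2) \<le> 4 * real n ^ 3 / 3"
proof -
  have "(\<Sum>j<n. (2 * real j + 1)\<^sup>2) = (4 * real n ^ 3 - real n) / 3"
    by (induction n) (simp_all add: power2_eq_square power3_eq_cube field_simps)
  then show ?thesis by simp
qed

section \<open>Deviations of labels proportional to the weights\<close>

context
  fixes S :: "'a set" and \<kappa> w :: "'a \<Rightarrow> nat" and \<phi> :: "'a \<Rightarrow> real" and s :: real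
  assumes fin: "finite S" and inj: "inj_on \<kappa> S" and W: "sum w S > 0"
    and \<phi>: "\<And>u. u \<in> S \<Longrightarrow> \<phi> u = s * real (w u)"
begin

lemma sum_label: "A \<subseteq> S \<Longrightarrow> sum \<phi> A = s * real (sum w A)"
  using \<phi> by (simp add: sum_distrib_left subset_eq cong: sum.cong)

lemma deviation_weight: "deviation S \<kappa> w \<phi> t = s * (real (sum w (used S \<kappa> w t)) - real t / 4)"
proof -
  have "real (sum w S) > 0" using W by (simp del: of_nat_sum)
  moreover have "sum \<phi> S = s * real (sum w S)" by (rule sum_label) simp
  moreover have "sum \<phi> (used S \<kappa> w t) = s * real (sum w (used S \<kappa> w t))"
    by (rule sum_label) (auto simp: used_def)
  ultimately show ?thesis
    by (simp add: deviation_def field_simps del: of_nat_sum)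
qed

text \<open>At the midpoint of the interval of \<open>v\<close>, consumption at constant speed has
  taken half of its label, whereas \<open>before\<close> has counted none of it.\<close>

lemma own_deviation_weight:
  assumes "v \<in> S"
  shows "sum \<phi> (before S \<kappa> v) - real (pos S \<kappa> w v) / (4 * real (sum w S)) * sum \<phi> S = - \<phi> v / 2"
proof -
  have "real (sum w S) > 0" using W by (simp del: of_nat_sum)
  moreover have "sum \<phi> S = s * real (sum w S)" by (rule sum_label) simp
  moreover have "sum \<phi> (before S \<kappa> v) = s * real (sum w (before S \<kappa> v))"
    by (rule sum_label) (rule before_subset)
  ultimately show ?thesis
    using \<phi>[OF assms] by (simp add: pos_def field_simps del: of_nat_sum)
qed

text \<open>On the interval of \<open>v\<close> the deviation, up to the factor \<open>s\<close>, is
  a sawtooth: it falls from 0 to \<open>- w v / 2\<close>, jumps to \<open>w v / 2\<close> and falls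
  back to 0. It is odd about the midpoint.\<close>

lemma sum_deviation_weight: "(\<Sum>k<2 * sum w S. deviation S \<kappa> w \<phi> (2 * k + 1)) = 0"
proof -
  have "(\<Sum>k<2 * sum w S. deviation S \<kappa> w \<phi> (2 * k + 1))
     = s * (\<Sum>k<2 * sum w S. real (sum w (used S \<kappa> w (2 * k + 1))) - real (2 * k + 1) / 4)"
    unfolding deviation_weight by (rule sum_distrib_left[symmetric])
  also have "(\<Sum>k<2 * sum w S. real (sum w (used S \<kappa> w (2 * k + 1))) - real (2 * k + 1) / 4) = 0"
  proof (subst sum_observations[OF fin inj, where h = "\<lambda>t U. real (sum w U) - real t / 4"], rule sum.neutral, rule ballI)
    fix v assume v: "v \<in> S"
    let ?c = "sum w (before S \<kappa> v)"
    have "(\<Sum>j<w v. real (sum w (insert v (before S \<kappa> v))) - real (4 * ?c + 2 * w v + 2 * j + 1) / 4)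
        = (\<Sum>j<w v. (2 * real (w v - Suc j) + 1) / 4)"
      using fin by (intro sum.cong) (auto simp: field_simps of_nat_diff)
    also have "\<dots> = (\<Sum>j<w v. (2 * real j + 1) / 4)"
      by (rule sum.nat_diff_reindex[of "\<lambda>j. (2 * real j + 1) / 4"])
    also have "\<dots> = - (\<Sum>j<w v. real ?c - real (4 * ?c + 2 * j + 1) / 4)"
      unfolding sum_negf[symmetric] by (intro sum.cong) (auto simp: field_simps)
    finally show "(\<Sum>j<w v. real ?c - real (4 * ?c + 2 * j + 1) / 4) +
      (\<Sum>j<w v. real (sum w (insert v (before S \<kappa> v))) - real (4 * ?c + 2 * w v + 2 * j + 1) / 4) = 0"
      by simp
  qed
  finally show ?thesis by simp
qed

text \<open>The sawtooth values are spread evenly over an interval of length \<open>w v\<close>,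
  with variance at most \<open>(w v)\<^sup>2 / 12\<close>, and there are \<open>2 * w v\<close> of
  them.\<close>

lemma sum_deviation_weight_squares:
  "(\<Sum>k<2 * sum w S. (deviation S \<kappa> w \<phi> (2 * k + 1))\<^sup>2) \<le> s\<^sup>2 * (\<Sum>v\<in>S. real (w v) ^ 3) / 6"
proof -
  have "(\<Sum>k<2 * sum w S. (deviation S \<kappa> w \<phi> (2 * k + 1))\<^sup>2)
     = s\<^sup>2 * (\<Sum>k<2 * sum w S. (real (sum w (used S \<kappa> w (2 * k + 1))) - real (2 * k + 1) / 4)\<^sup>2)"
    unfolding deviation_weight power_mult_distrib by (rule sum_distrib_left[symmetric])
  also have "(\<Sum>k<2 * sum w S. (real (sum w (used S \<kappa> w (2 * k + 1))) - real (2 * k + 1) / 4)\<^sup>2)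
     \<le> (\<Sum>v\<in>S. real (w v) ^ 3 / 6)"
  proof (subst sum_observations[OF fin inj, where h = "\<lambda>t U. (real (sum w U) - real t / 4)\<^sup>2"], rule sum_mono)
    fix v assume v: "v \<in> S"
    let ?c = "sum w (before S \<kappa> v)"
    have "(\<Sum>j<w v. (real ?c - real (4 * ?c + 2 * j + 1) / 4)\<^sup>2) = (\<Sum>j<w v. (2 * real j + 1)\<^sup>2 / 16)"
      by (intro sum.cong) (auto simp: field_simps power2_eq_square)
    also have "\<dots> \<le> real (w v) ^ 3 / 12"
      using sum_odd_squares_le[of "w v"] by (simp add: sum_divide_distrib[symmetric])
    moreover have "(\<Sum>j<w v. (real (sum w (insert v (before S \<kappa> v))) - real (4 * ?c + 2 * w v + 2 * j + 1) / 4)\<^sup>2)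
      = (\<Sum>j<w v. (2 * real (w v - Suc j) + 1)\<^sup>2 / 16)"
      using fin by (intro sum.cong) (auto simp: field_simps power2_eq_square of_nat_diff)
    moreover have "\<dots> = (\<Sum>j<w v. (2 * real j + 1)\<^sup>2 / 16)"
      by (rule sum.nat_diff_reindex[of "\<lambda>j. (2 * real j + 1)\<^sup>2 / 16"])
    moreover have "\<dots> \<le> real (w v) ^ 3 / 12"
      using sum_odd_squares_le[of "w v"] by (simp add: sum_divide_distrib[symmetric])
    ultimately show "(\<Sum>j<w v. (real ?c - real (4 * ?c + 2 * j + 1) / 4)\<^sup>2) +
      (\<Sum>j<w v. (real (sum w (insert v (before S \<kappa> v))) - real (4 * ?c + 2 * w v + 2 * j + 1) / 4)\<^sup>2) \<le> real (w v) ^ 3 / 6"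
      by linarith
  qed
  finally show ?thesis using sum_divide_distrib[of "\<lambda>v. real (w v) ^ 3" S 6] by (simp add: mult_left_mono)
qed

end

section \<open>Families of orders with small mean square\<close>

text \<open>The elements with \<open>g \<ge> 0\<close> are merged with those with
  \<open>g < 0\<close>, using the weights \<open>\<bar>g\<bar>\<close> and all odd shifts. The term
  \<open>g v / 2\<close> cancels the element's own deviation, leaving the sawtooth of the other set
  at a time equidistributed over the shifts.\<close>

lemma average_orders:
  fixes g :: "'a \<Rightarrow> int" and Q :: real
  assumes fin: "finite I" and zero: "sum g I = 0" and Q: "\<And>v. v \<in> I \<Longrightarrow> (real_of_int (g v))\<^sup>2 \<le> Q"
  obtains N :: nat and K :: "nat \<Rightarrow> 'a \<Rightarrow> nat" and c :: "nat \<Rightarrow> real" where "N > 0"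
    "\<And>k. k < N \<Longrightarrow> inj_on (K k) I"
    "\<And>v. v \<in> I \<Longrightarrow> (\<Sum>k<N. (\<Sum>u\<in>before I (K k) v. real_of_int (g u)) + g v / 2 - c k) = 0"
    "\<And>v. v \<in> I \<Longrightarrow> (\<Sum>k<N. ((\<Sum>u\<in>before I (K k) v. real_of_int (g u)) + g v / 2 - c k)\<^sup>2) \<le> N * Q / 12"
proof -
  obtain \<kappa> :: "'a \<Rightarrow> nat" where \<kappa>: "inj_on \<kappa> I"
    using finite_imp_inj_to_nat_seg[OF fin] by auto
  define X where "X = {v \<in> I. g v \<ge> 0}"
  define Y where "Y = {v \<in> I. g v < 0}"
  define w where "w v = nat \<bar>g v\<bar>" for v
  define \<phi> where "\<phi> v = real_of_int (g v)" for v
  have I: "I = X \<union> Y" "X \<inter> Y = {}" "finite X" "finite Y"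
    using fin by (auto simp: X_def Y_def)
  have \<phi>X: "\<phi> v = 1 * real (w v)" if "v \<in> X" for v using that by (simp add: \<phi>_def w_def X_def)
  have \<phi>Y: "\<phi> v = - 1 * real (w v)" if "v \<in> Y" for v using that by (simp add: \<phi>_def w_def Y_def)
  have zero': "sum \<phi> (X \<union> Y) = 0"
    using zero unfolding \<phi>_def I(1)[symmetric] by (simp flip: of_int_sum)
  have "sum \<phi> X = real (sum w X)" using \<phi>X by simp
  moreover have "sum \<phi> Y = - real (sum w Y)" using \<phi>Y by (simp add: sum_negf)
  moreover have "sum \<phi> (X \<union> Y) = sum \<phi> X + sum \<phi> Y" using I by (simp add: sum.union_disjoint)
  ultimately have WXY: "sum w Y = sum w X" using zero' by linarith
  have inj: "inj_on \<kappa> X" "inj_on \<kappa> Y" using \<kappa> by (auto simp: I(1) inj_on_Un)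
  show thesis
  proof (cases "sum w X = 0")
    \<comment> \<open>All labels vanish, so a single arbitrary order will do.\<close>
    case True
    then have "w v = 0" if "v \<in> I" for v
      using that WXY I by auto
    then have g0: "g v = 0" if "v \<in> I" for v using that by (simp add: w_def)
    have z: "(\<Sum>u\<in>before I \<kappa> v. real_of_int (g u)) = 0" for v
      by (rule sum.neutral) (use g0 before_subset[of I \<kappa> v] in auto)
    have Q0: "Q \<ge> 0" if "v \<in> I" for v using Q[OF that] g0[OF that] by simp
    show thesis
      by (rule that[of 1 "\<lambda>_. \<kappa>" "\<lambda>_. 0"]) (use \<kappa> z g0 Q0 in auto)
  next
    case False
    define W where "W = sum w X"
    have W: "W > 0" "sum w X = W" "sum w Y = W" using False WXY by (simp_all add: W_def)
    have "\<exists>K c. inj_on K I \<and>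
        (\<forall>v\<in>X. sum \<phi> (before I K v) + \<phi> v / 2 - c = deviation Y \<kappa> w \<phi> ((2 * k + 1 + pos X \<kappa> w v) mod (4 * W))) \<and>
        (\<forall>v\<in>Y. sum \<phi> (before I K v) + \<phi> v / 2 - c = deviation X \<kappa> w \<phi> ((pos Y \<kappa> w v + 4 * W - (2 * k + 1)) mod (4 * W)))"
      if "k < 2 * W" for k
    proof -
      have r: "odd (2 * k + 1)" "2 * k + 1 < 4 * W" using that by auto
      obtain K where K: "inj_on K (X \<union> Y)"
        "\<And>\<phi>. sum \<phi> (X \<union> Y) = (0::real) \<Longrightarrow>
         \<exists>c. (\<forall>v\<in>X. sum \<phi> (before (X \<union> Y) K v) - c =
              sum \<phi> (before X \<kappa> v) - real (pos X \<kappa> w v) / (4 * real W) * sum \<phi> X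
              + deviation Y \<kappa> w \<phi> ((2 * k + 1 + pos X \<kappa> w v) mod (4 * W))) \<and>
           (\<forall>v\<in>Y. sum \<phi> (before (X \<union> Y) K v) - c =
              sum \<phi> (before Y \<kappa> v) - real (pos Y \<kappa> w v) / (4 * real W) * sum \<phi> Y
              + deviation X \<kappa> w \<phi> ((pos Y \<kappa> w v + 4 * W - (2 * k + 1)) mod (4 * W)))"
        using merge_orders[OF I(3,4,2) inj W(2,3,1) r] by metis
      from K(2)[OF zero'] obtain c where c:
        "\<And>v. v \<in> X \<Longrightarrow> sum \<phi> (before (X \<union> Y) K v) - c =
              sum \<phi> (before X \<kappa> v) - real (pos X \<kappa> w v) / (4 * real W) * sum \<phi> X
              + deviation Y \<kappa> w \<phi> ((2 * k + 1 + pos X \<kappa> w v) mod (4 * W))"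
        "\<And>v. v \<in> Y \<Longrightarrow> sum \<phi> (before (X \<union> Y) K v) - c =
              sum \<phi> (before Y \<kappa> v) - real (pos Y \<kappa> w v) / (4 * real W) * sum \<phi> Y
              + deviation X \<kappa> w \<phi> ((pos Y \<kappa> w v + 4 * W - (2 * k + 1)) mod (4 * W))"
        by blast
      have "sum \<phi> (before I K v) + \<phi> v / 2 - c = deviation Y \<kappa> w \<phi> ((2 * k + 1 + pos X \<kappa> w v) mod (4 * W))"
        if "v \<in> X" for v
        using c(1)[OF that] own_deviation_weight[OF I(3) inj(1), where w = w and \<phi> = \<phi> and s = 1, unfolded W(2), OF W(1) \<phi>X that]
        unfolding I(1) by linarith
      moreover have "sum \<phi> (before I K v) + \<phi> v / 2 - c = deviation X \<kappa> w \<phi> ((pos Y \<kappa> w v + 4 * W - (2 * k + 1)) mod (4 * W))"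
        if "v \<in> Y" for v
        using c(2)[OF that] own_deviation_weight[OF I(4) inj(2), where w = w and \<phi> = \<phi> and s = "- 1", unfolded W(3), OF W(1) \<phi>Y that]
        unfolding I(1) by linarith
      ultimately show ?thesis using K(1) unfolding I(1) by blast
    qed
    then obtain K c where K: "\<And>k. k < 2 * W \<Longrightarrow> inj_on (K k) I"
      and cX: "\<And>k v. k < 2 * W \<Longrightarrow> v \<in> X \<Longrightarrow> sum \<phi> (before I (K k) v) + \<phi> v / 2 - c k =
          deviation Y \<kappa> w \<phi> ((2 * k + 1 + pos X \<kappa> w v) mod (4 * W))"
      and cY: "\<And>k v. k < 2 * W \<Longrightarrow> v \<in> Y \<Longrightarrow> sum \<phi> (before I (K k) v) + \<phi> v / 2 - c k =
          deviation X \<kappa> w \<phi> ((pos Y \<kappa> w v + 4 * W - (2 * k + 1)) mod (4 * W))"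
      by metis
    have w2: "(real (w v))\<^sup>2 \<le> Q" if "v \<in> I" for v using Q[OF that] by (simp add: w_def)
    have cube: "(\<Sum>v\<in>Z. real (w v) ^ 3) / 6 \<le> real (2 * W) * Q / 12" if "Z \<subseteq> I" "sum w Z = W" for Z
    proof -
      have "(\<Sum>v\<in>Z. real (w v) ^ 3) \<le> (\<Sum>v\<in>Z. real (w v) * Q)"
        using that(1) w2 by (intro sum_mono) (auto simp: power3_eq_cube power2_eq_square mult.assoc intro!: mult_left_mono)
      also have "\<dots> = real W * Q" using that(2) by (simp add: sum_distrib_right[symmetric] flip: of_nat_sum)
      finally show ?thesis by (simp add: mult.commute)
    qed
    note sX = sum_deviation_weight[OF I(3) inj(1), where w = w and \<phi> = \<phi> and s = 1, unfolded W(2), OF W(1) \<phi>X]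
      sum_deviation_weight_squares[OF I(3) inj(1), where w = w and \<phi> = \<phi> and s = 1, unfolded W(2), OF W(1) \<phi>X]
    note sY = sum_deviation_weight[OF I(4) inj(2), where w = w and \<phi> = \<phi> and s = "- 1", unfolded W(3), OF W(1) \<phi>Y]
      sum_deviation_weight_squares[OF I(4) inj(2), where w = w and \<phi> = \<phi> and s = "- 1", unfolded W(3), OF W(1) \<phi>Y]
    have "(\<Sum>k<2 * W. sum \<phi> (before I (K k) v) + \<phi> v / 2 - c k) = 0 \<and>
       (\<Sum>k<2 * W. (sum \<phi> (before I (K k) v) + \<phi> v / 2 - c k)\<^sup>2) \<le> real (2 * W) * Q / 12" if v: "v \<in> I" for v
    proof (cases "v \<in> X")
      case True
      have "(\<Sum>k<2 * W. sum \<phi> (before I (K k) v) + \<phi> v / 2 - c k) = 0"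
        using sum_times_shift[OF even_pos, of "deviation Y \<kappa> w \<phi>" X \<kappa> w v W] sY(1) cX[OF _ True] by simp
      moreover have "(\<Sum>k<2 * W. (sum \<phi> (before I (K k) v) + \<phi> v / 2 - c k)\<^sup>2) \<le> real (2 * W) * Q / 12"
        using sum_times_shift[OF even_pos, of "\<lambda>t. (deviation Y \<kappa> w \<phi> t)\<^sup>2" X \<kappa> w v W] sY(2) cX[OF _ True]
          cube[OF _ W(3)] I by simp
      ultimately show ?thesis by simp
    next
      case False
      then have vY: "v \<in> Y" using v I by auto
      have "(\<Sum>k<2 * W. sum \<phi> (before I (K k) v) + \<phi> v / 2 - c k) = 0"
        using sum_times_reflect[OF even_pos, of "deviation X \<kappa> w \<phi>" Y \<kappa> w v W] sX(1) cY[OF _ vY] by simp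
      moreover have "(\<Sum>k<2 * W. (sum \<phi> (before I (K k) v) + \<phi> v / 2 - c k)\<^sup>2) \<le> real (2 * W) * Q / 12"
        using sum_times_reflect[OF even_pos, of "\<lambda>t. (deviation X \<kappa> w \<phi> t)\<^sup>2" Y \<kappa> w v W] sX(2) cY[OF _ vY]
          cube[OF _ W(2)] I by simp
      ultimately show ?thesis by simp
    qed
    then show thesis using W(1) K by (intro that[of "2 * W" K c]) (auto simp: \<phi>_def)
  qed
qed

text \<open>
  The partial sums across the main direction are the sum of a contribution \<open>a i\<close> of one part and the current
  state of the other part.  Since both average to zero over their own shifts, the mixed
  terms disappear and the variances add up.
\<close>

lemma average_cost_one_side:
  fixes f g :: "'a \<Rightarrow> real" and Q :: real and a c :: "nat \<Rightarrow> real" and K :: "nat \<Rightarrow> 'a \<Rightarrow> nat" and T :: "nat \<Rightarrow> nat"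
  assumes fin: "finite J" and inj: "\<And>j. j < N' \<Longrightarrow> inj_on (K j) J"
    and F: "sum w J = F" "F > 0" and f: "\<And>u. u \<in> J \<Longrightarrow> f u = s * real (w u)" and s: "s\<^sup>2 = 1"
    and Q: "\<And>u. u \<in> J \<Longrightarrow> (f u)\<^sup>2 + (g u)\<^sup>2 \<le> Q"
    and g0: "\<And>u. u \<in> J \<Longrightarrow> (\<Sum>j<N'. sum g (before J (K j) u) + g u / 2 - c j) = 0"
    and g2: "\<And>u. u \<in> J \<Longrightarrow> (\<Sum>j<N'. (sum g (before J (K j) u) + g u / 2 - c j)\<^sup>2) \<le> N' * Q / 12"
    and a0: "(\<Sum>i<N. a i) = 0" and a2: "(\<Sum>i<N. (a i)\<^sup>2) \<le> N * Q / 12"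
    and T: "\<And>h :: nat \<Rightarrow> real. (\<Sum>k<2 * F. h (T k)) = (\<Sum>k<2 * F. h (2 * k + 1))"
  shows "(\<Sum>i<N. \<Sum>j<N'. \<Sum>k<2 * F. (deviation J (K j) w f (T k))\<^sup>2 + (a i + (sum g (used J (K j) w (T k)) - c j))\<^sup>2)
    \<le> real N * real N' * real (2 * F) * (Q / 4 + (\<Sum>u\<in>J. real (w u) * (g u)\<^sup>2) / (6 * real F))"
proof -
  define G where "G j u = sum g (before J (K j) u) + g u / 2 - c j" for j u
  define H where "H j t = sum g (used J (K j) w t) - c j" for j t
  \<comment> \<open>Around \<open>u\<close> the observed states are \<open>G j u - g u / 2\<close>
    and \<open>G j u + g u / 2\<close>, each seen \<open>w u\<close> times. \<open>S1\<close> and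
    \<open>S2\<close> are the resulting first and second moments.\<close>
  define S1 where "S1 j = (\<Sum>u\<in>J. 2 * real (w u) * G j u)" for j
  define S2 where "S2 j = (\<Sum>u\<in>J. 2 * real (w u) * ((G j u)\<^sup>2 + (g u)\<^sup>2 / 4))" for j
  define D where "D = (\<Sum>u\<in>J. real (w u) ^ 3) / 6"
  have ins: "sum g (insert u (before J (K j) u)) = sum g (before J (K j) u) + g u" for j u
    using fin by simp
  have H1: "(\<Sum>k<2 * F. H j (2 * k + 1)) = S1 j" if "j < N'" for j
    unfolding H_def S1_def F(1)[symmetric]
      sum_observations[OF fin inj[OF that], where h = "\<lambda>t U. sum g U - c j" and w = w] ins G_def
    by (rule sum.cong) (simp_all add: algebra_simps)
  have H2: "(\<Sum>k<2 * F. (H j (2 * k + 1))\<^sup>2) = S2 j" if "j < N'" for j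
    unfolding H_def S2_def F(1)[symmetric]
      sum_observations[OF fin inj[OF that], where h = "\<lambda>t U. (sum g U - c j)\<^sup>2" and w = w] ins G_def
    by (rule sum.cong) (simp_all add: algebra_simps power2_eq_square)
  have inner: "(\<Sum>k<2 * F. (deviation J (K j) w f (T k))\<^sup>2 + (a i + H j (T k))\<^sup>2)
      \<le> D + 2 * F * (a i)\<^sup>2 + 2 * a i * S1 j + S2 j" if j: "j < N'" for i j
  proof -
    have "(\<Sum>k<2 * F. (deviation J (K j) w f (T k))\<^sup>2 + (a i + H j (T k))\<^sup>2)
      = (\<Sum>k<2 * F. (deviation J (K j) w f (2 * k + 1))\<^sup>2 + (a i + H j (2 * k + 1))\<^sup>2)"
      by (rule T)
    also have "\<dots> = (\<Sum>k<2 * F. (deviation J (K j) w f (2 * k + 1))\<^sup>2) + (\<Sum>k<2 * F. (a i)\<^sup>2)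
       + 2 * a i * (\<Sum>k<2 * F. H j (2 * k + 1)) + (\<Sum>k<2 * F. (H j (2 * k + 1))\<^sup>2)"
      by (simp add: sum.distrib sum_distrib_left power2_sum algebra_simps)
    also have "(\<Sum>k<2 * F. (deviation J (K j) w f (2 * k + 1))\<^sup>2) \<le> D"
      using sum_deviation_weight_squares[OF fin inj[OF j], where w = w and \<phi> = f and s = s, unfolded F(1), OF F(2) f] s
      by (simp add: D_def)
    finally show ?thesis using H1[OF j] H2[OF j] by simp
  qed
  have "(\<Sum>i<N. \<Sum>j<N'. \<Sum>k<2 * F. (deviation J (K j) w f (T k))\<^sup>2 + (a i + H j (T k))\<^sup>2)
     \<le> (\<Sum>i<N. \<Sum>j<N'. D + 2 * F * (a i)\<^sup>2 + 2 * a i * S1 j + S2 j)"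
    by (intro sum_mono inner) auto
  also have "\<dots> = N * (N' * D) + N' * (2 * F * (\<Sum>i<N. (a i)\<^sup>2)) + 2 * (\<Sum>i<N. a i) * (\<Sum>j<N'. S1 j) + N * (\<Sum>j<N'. S2 j)"
    by (simp add: sum.distrib sum_distrib_left sum_distrib_right algebra_simps)
  also have "\<dots> = N * (N' * D) + N' * (2 * F * (\<Sum>i<N. (a i)\<^sup>2)) + N * (\<Sum>j<N'. S2 j)"
    using a0 by simp
  also have "(\<Sum>j<N'. S2 j) = (\<Sum>u\<in>J. 2 * real (w u) * ((\<Sum>j<N'. (G j u)\<^sup>2) + N' * (g u)\<^sup>2 / 4))"
    unfolding S2_def by (subst sum.swap) (simp add: sum_distrib_left[symmetric] sum.distrib)
  also have "\<dots> \<le> (\<Sum>u\<in>J. 2 * real (w u) * (N' * Q / 12 + N' * (g u)\<^sup>2 / 4))"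
    using g2 by (intro sum_mono mult_left_mono add_right_mono) (auto simp: G_def)
  also have "\<dots> = N' * (F * Q / 6 + (\<Sum>u\<in>J. real (w u) * (g u)\<^sup>2) / 2)"
    by (simp add: sum.distrib sum_distrib_left sum_distrib_right sum_divide_distrib F(1)[symmetric] algebra_simps)
  also have "2 * F * (\<Sum>i<N. (a i)\<^sup>2) \<le> 2 * F * (N * Q / 12)"
    using a2 by (intro mult_left_mono) auto
  \<comment> \<open>A vector with a large component across has a small one along. This saves a sixth
    of the sum of \<open>w u * (g u)\<^sup>2\<close>, against the half charged by \<open>S2\<close>;
    a third remains.\<close>
  also have "D \<le> (\<Sum>u\<in>J. real (w u) * (Q - (g u)\<^sup>2)) / 6"
    unfolding D_def
  proof (intro divide_right_mono sum_mono)
    fix u assume u: "u \<in> J"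
    have "(real (w u))\<^sup>2 \<le> Q - (g u)\<^sup>2" using Q[OF u] f[OF u] s by (simp add: power_mult_distrib)
    then show "real (w u) ^ 3 \<le> real (w u) * (Q - (g u)\<^sup>2)"
      by (simp add: power3_eq_cube power2_eq_square mult.assoc mult_left_mono)
  qed simp
  also have "\<dots> = (F * Q - (\<Sum>u\<in>J. real (w u) * (g u)\<^sup>2)) / 6"
    by (simp add: sum_subtractf sum_distrib_right right_diff_distrib F(1)[symmetric])
  finally have "(\<Sum>i<N. \<Sum>j<N'. \<Sum>k<2 * F. (deviation J (K j) w f (T k))\<^sup>2 + (a i + H j (T k))\<^sup>2)
    \<le> N * (N' * ((F * Q - (\<Sum>u\<in>J. real (w u) * (g u)\<^sup>2)) / 6)) + N' * (2 * F * (N * Q / 12)) +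
      N * (N' * (F * Q / 6 + (\<Sum>u\<in>J. real (w u) * (g u)\<^sup>2) / 2))"
    by (simp add: mult_left_mono)
  also have "\<dots> = real N * real N' * real (2 * F) * (Q / 4 + (\<Sum>u\<in>J. real (w u) * (g u)\<^sup>2) / (6 * real F))"
    using F(2) by (simp add: field_simps)
  finally show ?thesis by (simp add: H_def)
qed

lemma exists_le_average3:
  fixes c :: "nat \<Rightarrow> nat \<Rightarrow> nat \<Rightarrow> real" and B :: real
  assumes "N > 0" "N' > 0" "M > 0" and le: "(\<Sum>i<N. \<Sum>j<N'. \<Sum>k<M. c i j k) \<le> real N * real N' * real M * B"
  shows "\<exists>i<N. \<exists>j<N'. \<exists>k<M. c i j k \<le> B"
proof (rule ccontr)
  assume "\<not> ?thesis"
  then have "c i j k > B" if "i < N" "j < N'" "k < M" for i j k using that by (meson not_le)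
  then have "(\<Sum>i<N. \<Sum>j<N'. \<Sum>k<M. B) < (\<Sum>i<N. \<Sum>j<N'. \<Sum>k<M. c i j k)"
    using assms(1-3) by (intro sum_strict_mono) auto
  then show False using le by simp
qed

text \<open>The two parts are merged along \<open>f\<close> with the weights
  \<open>\<bar>f\<bar>\<close>, each part being ordered by its averaged family for \<open>g\<close>.
  The cost is averaged over both families and the shift, and some choice is at most the mean.
  Elements of \<open>I\<close> observe the states of \<open>J\<close> and conversely, hence the
  crossed indices in the bound.\<close>

lemma exists_order:
  fixes f g :: "'a \<Rightarrow> int" and Q :: real and F :: nat
  assumes fin: "finite I" "finite J" and disj: "I \<inter> J = {}"
    and f: "\<And>v. v \<in> I \<Longrightarrow> f v > 0" "\<And>v. v \<in> J \<Longrightarrow> f v < 0"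
    and F: "sum f I = int F" "sum f J = - int F" "F > 0"
    and g: "sum g I = 0" "sum g J = 0"
    and Q: "\<And>v. v \<in> I \<union> J \<Longrightarrow> (real_of_int (f v))\<^sup>2 + (real_of_int (g v))\<^sup>2 \<le> Q"
  obtains K :: "'a \<Rightarrow> nat" and cf cg :: real where "inj_on K (I \<union> J)"
    "(\<Sum>v\<in>I \<union> J. ((\<Sum>u\<in>before (I \<union> J) K v. real_of_int (f u)) + f v / 2 - cf)\<^sup>2 +
        ((\<Sum>u\<in>before (I \<union> J) K v. real_of_int (g u)) + g v / 2 - cg)\<^sup>2)
      \<le> real (card I) * (Q / 4 + (\<Sum>u\<in>J. \<bar>real_of_int (f u)\<bar> * (real_of_int (g u))\<^sup>2) / (6 * real F)) +
        real (card J) * (Q / 4 + (\<Sum>u\<in>I. \<bar>real_of_int (f u)\<bar> * (real_of_int (g u))\<^sup>2) / (6 * real F))"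
proof -
  define \<phi> \<gamma> where "\<phi> v = real_of_int (f v)" and "\<gamma> v = real_of_int (g v)" for v
  define w where "w v = nat \<bar>f v\<bar>" for v
  have g2: "(real_of_int (g v))\<^sup>2 \<le> Q" if "v \<in> I \<union> J" for v
    using Q[OF that] zero_le_power2[of "real_of_int (f v)"] by linarith
  have g2I: "(real_of_int (g v))\<^sup>2 \<le> Q" if "v \<in> I" for v using g2[of v] that by simp
  have g2J: "(real_of_int (g v))\<^sup>2 \<le> Q" if "v \<in> J" for v using g2[of v] that by simp
  have \<gamma>_eq: "real_of_int (g v) = \<gamma> v" for v by (simp add: \<gamma>_def)
  obtain N1 :: nat and K1 :: "nat \<Rightarrow> 'a \<Rightarrow> nat" and c1 where 1: "N1 > 0" "\<And>k. k < N1 \<Longrightarrow> inj_on (K1 k) I"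
    "\<And>v. v \<in> I \<Longrightarrow> (\<Sum>k<N1. sum \<gamma> (before I (K1 k) v) + \<gamma> v / 2 - c1 k) = 0"
    "\<And>v. v \<in> I \<Longrightarrow> (\<Sum>k<N1. (sum \<gamma> (before I (K1 k) v) + \<gamma> v / 2 - c1 k)\<^sup>2) \<le> N1 * Q / 12"
    by (rule average_orders[OF fin(1) g(1) g2I, unfolded \<gamma>_eq]) (assumption, (rule that; simp))
  obtain N2 :: nat and K2 :: "nat \<Rightarrow> 'a \<Rightarrow> nat" and c2 where 2: "N2 > 0" "\<And>k. k < N2 \<Longrightarrow> inj_on (K2 k) J"
    "\<And>v. v \<in> J \<Longrightarrow> (\<Sum>k<N2. sum \<gamma> (before J (K2 k) v) + \<gamma> v / 2 - c2 k) = 0"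
    "\<And>v. v \<in> J \<Longrightarrow> (\<Sum>k<N2. (sum \<gamma> (before J (K2 k) v) + \<gamma> v / 2 - c2 k)\<^sup>2) \<le> N2 * Q / 12"
    by (rule average_orders[OF fin(2) g(2) g2J, unfolded \<gamma>_eq]) (assumption, (rule that; simp))
  have \<phi>I: "\<phi> v = 1 * real (w v)" if "v \<in> I" for v using f(1)[OF that] by (simp add: \<phi>_def w_def)
  have \<phi>J: "\<phi> v = - 1 * real (w v)" if "v \<in> J" for v using f(2)[OF that] by (simp add: \<phi>_def w_def)
  have sI: "sum \<phi> I = real F" and sJ: "sum \<phi> J = - real F"
    using F(1,2) by (simp_all add: \<phi>_def flip: of_int_sum)
  have "sum \<phi> I = real (sum w I)" using \<phi>I by simp
  moreover have "sum \<phi> J = - real (sum w J)" using \<phi>J by (simp add: sum_negf)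
  ultimately have WI: "sum w I = F" and WJ: "sum w J = F" using sI sJ by linarith+
  have z: "sum \<phi> (I \<union> J) = 0" "sum \<gamma> (I \<union> J) = 0"
    using sI sJ g fin disj by (simp_all add: sum.union_disjoint \<gamma>_def flip: of_int_sum)
  have \<gamma>0: "sum \<gamma> I = 0" "sum \<gamma> J = 0" using g by (simp_all add: \<gamma>_def flip: of_int_sum)
  let ?TI = "\<lambda>i v k. (2 * k + 1 + pos I (K1 i) w v) mod (4 * F)"
  let ?TJ = "\<lambda>j v k. (pos J (K2 j) w v + 4 * F - (2 * k + 1)) mod (4 * F)"
  define GI where "GI i v = sum \<gamma> (before I (K1 i) v) + \<gamma> v / 2 - c1 i" for i v
  define GJ where "GJ j v = sum \<gamma> (before J (K2 j) v) + \<gamma> v / 2 - c2 j" for j v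
  define CI where "CI i j t v = (deviation J (K2 j) w \<phi> t)\<^sup>2 + (GI i v + (sum \<gamma> (used J (K2 j) w t) - c2 j))\<^sup>2" for i j t v
  define CJ where "CJ i j t v = (deviation I (K1 i) w \<phi> t)\<^sup>2 + (GJ j v + (sum \<gamma> (used I (K1 i) w t) - c1 i))\<^sup>2" for i j t v
  let ?c = "\<lambda>i j k. (\<Sum>v\<in>I. CI i j (?TI i v k) v) + (\<Sum>v\<in>J. CJ i j (?TJ j v k) v)"
  have merged: "\<exists>K cf cg. inj_on K (I \<union> J) \<and>
      (\<Sum>v\<in>I \<union> J. (sum \<phi> (before (I \<union> J) K v) + \<phi> v / 2 - cf)\<^sup>2 + (sum \<gamma> (before (I \<union> J) K v) + \<gamma> v / 2 - cg)\<^sup>2) = ?c i j k"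
    if ijk: "i < N1" "j < N2" "k < 2 * F" for i j k
  proof -
    \<comment> \<open>One key serves both disjoint parts, as \<open>merge_orders\<close>
      expects.\<close>
    define \<kappa> where "\<kappa> v = (if v \<in> I then K1 i v else K2 j v)" for v
    have eqI: "\<kappa> u = K1 i u" if "u \<in> I" for u using that by (simp add: \<kappa>_def)
    have eqJ: "\<kappa> u = K2 j u" if "u \<in> J" for u using that disj by (auto simp: \<kappa>_def)
    have inj: "inj_on \<kappa> I" "inj_on \<kappa> J"
      using 1(2)[OF ijk(1)] 2(2)[OF ijk(2)] eqI eqJ by (simp_all cong: inj_on_cong)
    have r: "odd (2 * k + 1)" "2 * k + 1 < 4 * F" using ijk by auto
    obtain K where K: "inj_on K (I \<union> J)"
      "\<And>\<phi>. sum \<phi> (I \<union> J) = (0::real) \<Longrightarrow>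
         \<exists>c. (\<forall>v\<in>I. sum \<phi> (before (I \<union> J) K v) - c =
              sum \<phi> (before I \<kappa> v) - real (pos I \<kappa> w v) / (4 * real F) * sum \<phi> I
              + deviation J \<kappa> w \<phi> ((2 * k + 1 + pos I \<kappa> w v) mod (4 * F))) \<and>
           (\<forall>v\<in>J. sum \<phi> (before (I \<union> J) K v) - c =
              sum \<phi> (before J \<kappa> v) - real (pos J \<kappa> w v) / (4 * real F) * sum \<phi> J
              + deviation I \<kappa> w \<phi> ((pos J \<kappa> w v + 4 * F - (2 * k + 1)) mod (4 * F)))"
      using merge_orders[OF fin disj inj WI WJ F(3) r] by metis
    from K(2)[OF z(1)] obtain cf where cf:
      "\<And>v. v \<in> I \<Longrightarrow> sum \<phi> (before (I \<union> J) K v) - cf =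
              sum \<phi> (before I \<kappa> v) - real (pos I \<kappa> w v) / (4 * real F) * sum \<phi> I
              + deviation J \<kappa> w \<phi> ((2 * k + 1 + pos I \<kappa> w v) mod (4 * F))"
      "\<And>v. v \<in> J \<Longrightarrow> sum \<phi> (before (I \<union> J) K v) - cf =
              sum \<phi> (before J \<kappa> v) - real (pos J \<kappa> w v) / (4 * real F) * sum \<phi> J
              + deviation I \<kappa> w \<phi> ((pos J \<kappa> w v + 4 * F - (2 * k + 1)) mod (4 * F))"
      by blast
    from K(2)[OF z(2)] obtain cg where cg:
      "\<And>v. v \<in> I \<Longrightarrow> sum \<gamma> (before (I \<union> J) K v) - cg =
              sum \<gamma> (before I \<kappa> v) - real (pos I \<kappa> w v) / (4 * real F) * sum \<gamma> I
              + deviation J \<kappa> w \<gamma> ((2 * k + 1 + pos I \<kappa> w v) mod (4 * F))"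
      "\<And>v. v \<in> J \<Longrightarrow> sum \<gamma> (before (I \<union> J) K v) - cg =
              sum \<gamma> (before J \<kappa> v) - real (pos J \<kappa> w v) / (4 * real F) * sum \<gamma> J
              + deviation I \<kappa> w \<gamma> ((pos J \<kappa> w v + 4 * F - (2 * k + 1)) mod (4 * F))"
      by blast
    have cI: "before I \<kappa> v = before I (K1 i) v" "pos I \<kappa> w v = pos I (K1 i) w v" if "v \<in> I" for v
      using before_cong[OF eqI that] pos_cong[OF eqI that] by auto
    have cJ: "before J \<kappa> v = before J (K2 j) v" "pos J \<kappa> w v = pos J (K2 j) w v" if "v \<in> J" for v
      using before_cong[OF eqJ that] pos_cong[OF eqJ that] by auto
    have dI: "deviation I \<kappa> w \<psi> t = deviation I (K1 i) w \<psi> t" for \<psi> t by (rule deviation_cong[OF eqI])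
    have dJ: "deviation J \<kappa> w \<psi> t = deviation J (K2 j) w \<psi> t" for \<psi> t by (rule deviation_cong[OF eqJ])
    have "(sum \<phi> (before (I \<union> J) K v) + \<phi> v / 2 - cf)\<^sup>2 +
          (sum \<gamma> (before (I \<union> J) K v) + \<gamma> v / 2 - (cg + c1 i + c2 j))\<^sup>2 = CI i j (?TI i v k) v" if v: "v \<in> I" for v
    proof -
      have a: "sum \<phi> (before (I \<union> J) K v) + \<phi> v / 2 - cf = deviation J (K2 j) w \<phi> (?TI i v k)"
        using cf(1)[OF v] own_deviation_weight[OF fin(1) inj(1), where w = w and \<phi> = \<phi> and s = 1, unfolded WI, OF F(3) \<phi>I v]
        unfolding cI[OF v] dJ by linarith
      \<comment> \<open>Each part has sum zero across the main direction, so the drift terms vanish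
        and the deviation is a plain partial sum.\<close>
      have "sum \<gamma> (before (I \<union> J) K v) - cg = sum \<gamma> (before I (K1 i) v) + sum \<gamma> (used J (K2 j) w (?TI i v k))"
        using cg(1)[OF v] \<gamma>0 unfolding cI[OF v] dJ by (simp add: deviation_def)
      then have b: "sum \<gamma> (before (I \<union> J) K v) + \<gamma> v / 2 - (cg + c1 i + c2 j)
          = GI i v + (sum \<gamma> (used J (K2 j) w (?TI i v k)) - c2 j)" by (simp add: GI_def)
      show ?thesis unfolding a b CI_def ..
    qed
    moreover have "(sum \<phi> (before (I \<union> J) K v) + \<phi> v / 2 - cf)\<^sup>2 +
          (sum \<gamma> (before (I \<union> J) K v) + \<gamma> v / 2 - (cg + c1 i + c2 j))\<^sup>2 = CJ i j (?TJ j v k) v" if v: "v \<in> J" for v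
    proof -
      have a: "sum \<phi> (before (I \<union> J) K v) + \<phi> v / 2 - cf = deviation I (K1 i) w \<phi> (?TJ j v k)"
        using cf(2)[OF v] own_deviation_weight[OF fin(2) inj(2), where w = w and \<phi> = \<phi> and s = "- 1", unfolded WJ, OF F(3) \<phi>J v]
        unfolding cJ[OF v] dI by linarith
      have "sum \<gamma> (before (I \<union> J) K v) - cg = sum \<gamma> (before J (K2 j) v) + sum \<gamma> (used I (K1 i) w (?TJ j v k))"
        using cg(2)[OF v] \<gamma>0 unfolding cJ[OF v] dI by (simp add: deviation_def)
      then have b: "sum \<gamma> (before (I \<union> J) K v) + \<gamma> v / 2 - (cg + c1 i + c2 j)
          = GJ j v + (sum \<gamma> (used I (K1 i) w (?TJ j v k)) - c1 i)" by (simp add: GJ_def)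
      show ?thesis unfolding a b CJ_def ..
    qed
    ultimately show ?thesis using K(1) fin disj
      by (intro exI[of _ K] exI[of _ cf] exI[of _ "cg + c1 i + c2 j"]) (simp add: sum.union_disjoint)
  qed
  define BI where "BI = Q / 4 + (\<Sum>u\<in>J. real (w u) * (\<gamma> u)\<^sup>2) / (6 * real F)"
  define BJ where "BJ = Q / 4 + (\<Sum>u\<in>I. real (w u) * (\<gamma> u)\<^sup>2) / (6 * real F)"
  have Q': "(\<phi> u)\<^sup>2 + (\<gamma> u)\<^sup>2 \<le> Q" if "u \<in> I \<union> J" for u using Q[OF that] by (simp add: \<phi>_def \<gamma>_def)
  have shiftI: "(\<Sum>k<2 * F. h (?TI i v k)) = (\<Sum>k<2 * F. h (2 * k + 1))" for h :: "nat \<Rightarrow> real" and i v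
    by (rule sum_times_shift) simp
  have shiftJ: "(\<Sum>k<2 * F. h (?TJ j v k)) = (\<Sum>k<2 * F. h (2 * k + 1))" for h :: "nat \<Rightarrow> real" and j v
    by (rule sum_times_reflect) simp
  have T0: "(\<Sum>k<2 * F. h (2 * k + 1)) = (\<Sum>k<2 * F. h (2 * k + 1))" for h :: "nat \<Rightarrow> real" ..
  have I: "(\<Sum>i<N1. \<Sum>j<N2. \<Sum>k<2 * F. CI i j (?TI i v k) v) \<le> real N1 * real N2 * real (2 * F) * BI" if v: "v \<in> I" for v
  proof -
    have "(\<Sum>i<N1. \<Sum>j<N2. \<Sum>k<2 * F. CI i j (?TI i v k) v) = (\<Sum>i<N1. \<Sum>j<N2. \<Sum>k<2 * F. CI i j (2 * k + 1) v)"
      by (intro sum.cong refl shiftI)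
    also have "\<dots> \<le> real N1 * real N2 * real (2 * F) * BI"
      unfolding CI_def BI_def
      by (rule average_cost_one_side[OF fin(2) 2(2) WJ F(3) \<phi>J _ _ 2(3,4) _ _ T0])
        (use Q' 1(3,4)[OF v] in \<open>auto simp: GI_def\<close>)
    finally show ?thesis .
  qed
  have J: "(\<Sum>i<N1. \<Sum>j<N2. \<Sum>k<2 * F. CJ i j (?TJ j v k) v) \<le> real N1 * real N2 * real (2 * F) * BJ" if v: "v \<in> J" for v
  proof -
    have "(\<Sum>i<N1. \<Sum>j<N2. \<Sum>k<2 * F. CJ i j (?TJ j v k) v) = (\<Sum>j<N2. \<Sum>i<N1. \<Sum>k<2 * F. CJ i j (2 * k + 1) v)"
      by (subst sum.swap, intro sum.cong refl shiftJ)
    also have "\<dots> \<le> real N2 * real N1 * real (2 * F) * BJ"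
      unfolding CJ_def BJ_def
      by (rule average_cost_one_side[OF fin(1) 1(2) WI F(3) \<phi>I _ _ 1(3,4) _ _ T0])
        (use Q' 2(3,4)[OF v] in \<open>auto simp: GJ_def\<close>)
    finally show ?thesis by (simp add: mult_ac)
  qed
  have "(\<Sum>i<N1. \<Sum>j<N2. \<Sum>k<2 * F. ?c i j k) =
      (\<Sum>v\<in>I. \<Sum>i<N1. \<Sum>j<N2. \<Sum>k<2 * F. CI i j (?TI i v k) v) + (\<Sum>v\<in>J. \<Sum>i<N1. \<Sum>j<N2. \<Sum>k<2 * F. CJ i j (?TJ j v k) v)"
    unfolding sum.distrib
      sum.swap[of _ "{..<2 * F}" I] sum.swap[of _ "{..<2 * F}" J] sum.swap[of _ "{..<N2}" I] sum.swap[of _ "{..<N2}" J]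
      sum.swap[of _ "{..<N1}" I] sum.swap[of _ "{..<N1}" J] ..
  also have "\<dots> \<le> (\<Sum>v\<in>I. real N1 * real N2 * real (2 * F) * BI) + (\<Sum>v\<in>J. real N1 * real N2 * real (2 * F) * BJ)"
    by (intro add_mono sum_mono I J)
  also have "\<dots> = real N1 * real N2 * real (2 * F) * (real (card I) * BI + real (card J) * BJ)"
    by (simp add: algebra_simps)
  finally obtain i j k where ijk: "i < N1" "j < N2" "k < 2 * F" "?c i j k \<le> real (card I) * BI + real (card J) * BJ"
    using exists_le_average3[of N1 N2 "2 * F" ?c "real (card I) * BI + real (card J) * BJ"] 1(1) 2(1) F(3) by auto
  from merged[OF ijk(1-3)] ijk(4) obtain K cf cg where K: "inj_on K (I \<union> J)"
    "(\<Sum>v\<in>I \<union> J. (sum \<phi> (before (I \<union> J) K v) + \<phi> v / 2 - cf)\<^sup>2 + (sum \<gamma> (before (I \<union> J) K v) + \<gamma> v / 2 - cg)\<^sup>2)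
      \<le> real (card I) * BI + real (card J) * BJ"
    by (metis (no_types, lifting))
  show thesis
    by (rule that[OF K(1)]) (use K(2) in \<open>simp add: BI_def BJ_def w_def \<phi>_def \<gamma>_def\<close>)
qed

section \<open>Lattice points under a paraboloid\<close>

text \<open>Comparison of a sum with an integral, \<open>H\<close> acting as an antiderivative of
  \<open>h\<close>. The first lattice point, at distance below 1 from \<open>c\<close>, costs at
  most \<open>M\<close>; the increments of \<open>H\<close> pay for the others and
  telescope.\<close>

lemma sum_decreasing_le:
  fixes h H :: "real \<Rightarrow> real" and c \<rho> M :: real and T :: "int set"
  assumes fin: "finite T" and T: "\<And>x. x \<in> T \<Longrightarrow> c \<le> x \<and> x \<le> c + \<rho>" and \<rho>: "\<rho> \<ge> 0"
    and h: "\<And>u. 0 \<le> u \<Longrightarrow> u \<le> \<rho> \<Longrightarrow> 0 \<le> h u \<and> h u \<le> M"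
    and hH: "\<And>u. 1 \<le> u \<Longrightarrow> u \<le> \<rho> \<Longrightarrow> h u \<le> H u - H (u - 1)"
    and H: "\<And>u v. 0 \<le> u \<Longrightarrow> u \<le> v \<Longrightarrow> v \<le> \<rho> \<Longrightarrow> H u \<le> H v" and H0: "H 0 = 0"
  shows "(\<Sum>x\<in>T. h (x - c)) \<le> M + H \<rho>"
proof (cases "T = {}")
  case True
  then show ?thesis using h[of 0] H[of 0 \<rho>] H0 \<rho> by simp
next
  case False
  define u where "u = \<lceil>c\<rceil> - c"
  have u: "0 \<le> u" "u < 1" by (auto simp: u_def) linarith
  define k where "k = nat (Max T - \<lceil>c\<rceil>)"
  have max: "Max T \<in> T" using fin False by simp
  have ge: "x \<ge> \<lceil>c\<rceil>" if "x \<in> T" for x using T[OF that] by (simp add: ceiling_le_iff)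
  have k: "u + real k \<le> \<rho>" using T[OF max] ge[OF max] by (simp add: u_def k_def)
  have claim: "(\<Sum>j\<le>n. h (u + real j)) \<le> M + H (u + real n)" if "u + real n \<le> \<rho>" for n
    using that
  proof (induction n)
    case 0
    then show ?case using h[of u] H[of 0 u] H0 u by simp
  next
    case (Suc n)
    have "h (u + real (Suc n)) \<le> H (u + real (Suc n)) - H (u + real (Suc n) - 1)"
      using Suc.prems u by (intro hH) auto
    moreover have "u + real (Suc n) - 1 = u + real n" by simp
    ultimately show ?case using Suc by simp
  qed
  \<comment> \<open>Gaps in \<open>T\<close> may be filled because \<open>h\<close> is
    nonnegative.\<close>
  have "(\<Sum>x\<in>T. h (x - c)) \<le> (\<Sum>x\<in>(\<lambda>j. \<lceil>c\<rceil> + int j) ` {..k}. h (x - c))"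
  proof (rule sum_mono2)
    show "T \<subseteq> (\<lambda>j. \<lceil>c\<rceil> + int j) ` {..k}"
    proof
      fix x assume x: "x \<in> T"
      then have "x \<le> Max T" using fin by simp
      then show "x \<in> (\<lambda>j. \<lceil>c\<rceil> + int j) ` {..k}"
        using ge[OF x] by (intro image_eqI[of _ _ "nat (x - \<lceil>c\<rceil>)"]) (auto simp: k_def)
    qed
    fix x assume "x \<in> (\<lambda>j. \<lceil>c\<rceil> + int j) ` {..k} - T"
    then obtain j where j: "j \<le> k" "x = \<lceil>c\<rceil> + int j" by auto
    then have "x - c = u + real j" by (simp add: u_def)
    then show "0 \<le> h (x - c)" using h[of "u + real j"] u k j(1) by simp
  qed simp
  also have "\<dots> = (\<Sum>j\<le>k. h (u + real j))"
    by (subst sum.reindex) (auto simp: inj_on_def u_def algebra_simps)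
  also have "\<dots> \<le> M + H (u + real k)" by (rule claim[OF k])
  also have "\<dots> \<le> M + H \<rho>" using H[of "u + real k" \<rho>] u k by simp
  finally show ?thesis .
qed

text \<open>The points below \<open>c\<close> are reflected, so that both halves fall under the
  one-sided estimate.\<close>

lemma sum_even_decreasing_le:
  fixes h H :: "real \<Rightarrow> real" and c \<rho> M :: real and T :: "int set"
  assumes fin: "finite T" and T: "\<And>x. x \<in> T \<Longrightarrow> \<bar>x - c\<bar> \<le> \<rho>" and \<rho>: "\<rho> \<ge> 0"
    and h: "\<And>u. 0 \<le> u \<Longrightarrow> u \<le> \<rho> \<Longrightarrow> 0 \<le> h u \<and> h u \<le> M"
    and hH: "\<And>u. 1 \<le> u \<Longrightarrow> u \<le> \<rho> \<Longrightarrow> h u \<le> H u - H (u - 1)"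
    and H: "\<And>u v. 0 \<le> u \<Longrightarrow> u \<le> v \<Longrightarrow> v \<le> \<rho> \<Longrightarrow> H u \<le> H v" and H0: "H 0 = 0"
    and even: "\<And>u. h (- u) = h u"
  shows "(\<Sum>x\<in>T. h (x - c)) \<le> 2 * (M + H \<rho>)"
proof -
  let ?P = "{x \<in> T. c \<le> x}" and ?N = "{x \<in> T. x < c}"
  have "(\<Sum>x\<in>T. h (x - c)) = (\<Sum>x\<in>?P. h (x - c)) + (\<Sum>x\<in>?N. h (x - c))"
    using fin by (subst sum.union_disjoint[symmetric]) (auto intro!: sum.cong)
  also have "(\<Sum>x\<in>?P. h (x - c)) \<le> M + H \<rho>"
    by (rule sum_decreasing_le[OF _ _ \<rho> h hH H H0]) (use fin T in \<open>fastforce+\<close>)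
  also have "(\<Sum>x\<in>?N. h (x - c)) = (\<Sum>x\<in>uminus ` ?N. h (x - (- c)))"
  proof (subst sum.reindex)
    show "(\<Sum>x\<in>?N. h (x - c)) = sum ((\<lambda>x. h (real_of_int x - (- c))) \<circ> uminus) ?N"
    proof (rule sum.cong)
      fix x :: int
      show "h (x - c) = ((\<lambda>x. h (real_of_int x - (- c))) \<circ> uminus) x"
        using even[of "x - c"] by (simp add: algebra_simps)
    qed simp
  qed (simp add: inj_on_def)
  also have "\<dots> \<le> M + H \<rho>"
    by (rule sum_decreasing_le[OF _ _ \<rho> h hH H H0]) (use fin T in \<open>fastforce+\<close>)
  finally show ?thesis by simp
qed

text \<open>The cubic term is the area under the parabola, the quadratic term twice its
  maximum.\<close>

lemma sum_parabola_le:
  fixes c \<rho> :: real and T :: "int set"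
  assumes fin: "finite T" and T: "\<And>x. x \<in> T \<Longrightarrow> \<bar>x - c\<bar> \<le> \<rho>" and \<rho>: "\<rho> \<ge> 0"
  shows "(\<Sum>x\<in>T. \<rho>\<^sup>2 - (x - c)\<^sup>2) \<le> 4 / 3 * \<rho> ^ 3 + 2 * \<rho>\<^sup>2"
proof -
  have "(\<Sum>x\<in>T. \<rho>\<^sup>2 - (x - c)\<^sup>2) \<le> 2 * (\<rho>\<^sup>2 + (\<rho>\<^sup>2 * \<rho> - \<rho> ^ 3 / 3))"
  proof (rule sum_even_decreasing_le[OF fin T \<rho>, where h = "\<lambda>u. \<rho>\<^sup>2 - u\<^sup>2" and H = "\<lambda>u. \<rho>\<^sup>2 * u - u ^ 3 / 3"])
    fix u v :: real assume uv: "0 \<le> u" "u \<le> v" "v \<le> \<rho>"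
    have "v ^ 3 - u ^ 3 = (v - u) * (v\<^sup>2 + v * u + u\<^sup>2)" by algebra
    moreover have "v\<^sup>2 + v * u + u\<^sup>2 \<le> \<rho>\<^sup>2 + \<rho> * \<rho> + \<rho>\<^sup>2"
      using uv by (intro add_mono power_mono mult_mono) auto
    ultimately have "v ^ 3 - u ^ 3 \<le> (v - u) * (\<rho>\<^sup>2 + \<rho> * \<rho> + \<rho>\<^sup>2)"
      using uv by (simp add: mult_left_mono)
    then show "\<rho>\<^sup>2 * u - u ^ 3 / 3 \<le> \<rho>\<^sup>2 * v - v ^ 3 / 3"
      by (simp add: power2_eq_square algebra_simps)
  next
    fix u :: real assume "1 \<le> u"
    moreover have "\<rho>\<^sup>2 * u - u ^ 3 / 3 - (\<rho>\<^sup>2 * (u - 1) - (u - 1) ^ 3 / 3) = \<rho>\<^sup>2 - u\<^sup>2 + (u - 1 / 3)"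
      by (simp add: power2_eq_square power3_eq_cube field_simps)
    ultimately show "\<rho>\<^sup>2 - u\<^sup>2 \<le> \<rho>\<^sup>2 * u - u ^ 3 / 3 - (\<rho>\<^sup>2 * (u - 1) - (u - 1) ^ 3 / 3)"
      by linarith
  qed (use \<rho> in \<open>auto intro: power_mono\<close>)
  then show ?thesis by (simp add: power2_eq_square power3_eq_cube)
qed

text \<open>The leading term is the integral of the squared parabola over \<open>[-R, R]\<close>,
  and \<open>2 * R ^ 4\<close> is twice its maximum.\<close>

lemma sum_parabola_squares_le:
  fixes c R :: real and T :: "int set"
  assumes fin: "finite T" and T: "\<And>x. x \<in> T \<Longrightarrow> \<bar>x - c\<bar> \<le> R" and R: "R \<ge> 0"
  shows "(\<Sum>x\<in>T. (R\<^sup>2 - (x - c)\<^sup>2)\<^sup>2) \<le> 16 / 15 * R ^ 5 + 2 * R ^ 4"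
proof -
  let ?H = "\<lambda>u. R ^ 4 * u - 2 * R\<^sup>2 * u ^ 3 / 3 + u ^ 5 / 5"
  have "(\<Sum>x\<in>T. (R\<^sup>2 - (x - c)\<^sup>2)\<^sup>2) \<le> 2 * (R ^ 4 + ?H R)"
  proof (rule sum_even_decreasing_le[OF fin T R, where h = "\<lambda>u. (R\<^sup>2 - u\<^sup>2)\<^sup>2" and H = ?H])
    fix u :: real assume u: "0 \<le> u" "u \<le> R"
    have "(R\<^sup>2 - u\<^sup>2)\<^sup>2 \<le> (R\<^sup>2)\<^sup>2" using u by (intro power_mono) (auto intro: power_mono)
    then show "0 \<le> (R\<^sup>2 - u\<^sup>2)\<^sup>2 \<and> (R\<^sup>2 - u\<^sup>2)\<^sup>2 \<le> R ^ 4" by simp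
  next
    fix u v :: real assume uv: "0 \<le> u" "u \<le> v" "v \<le> R"
    have "\<exists>y. y > u \<and> y < v \<and> ?H v - ?H u = (v - u) * (R ^ 4 - 2 * R\<^sup>2 * y\<^sup>2 + y ^ 4)" if "u < v"
      by (rule MVT2[OF that]) (auto intro!: derivative_eq_intros simp: power2_eq_square)
    moreover have "R ^ 4 - 2 * R\<^sup>2 * y\<^sup>2 + y ^ 4 = (R\<^sup>2 - y\<^sup>2)\<^sup>2" for y by algebra
    ultimately have "?H v - ?H u \<ge> 0" if "u < v" using that by fastforce
    then show "?H u \<le> ?H v" using uv by (cases "u = v") auto
  next
    fix u assume u: "1 \<le> u" "u \<le> R"
    have "?H u - ?H (u - 1) - (R\<^sup>2 - u\<^sup>2)\<^sup>2 = 2 * R\<^sup>2 * (u - 1 / 3) - 2 * u ^ 3 + 2 * u\<^sup>2 - u + 1 / 5"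
      by (simp add: power2_eq_square power3_eq_cube field_simps eval_nat_numeral)
    \<comment> \<open>Replacing \<open>R\<close> by the smaller \<open>u\<close> cancels the cubic
      terms.\<close>
    moreover have "2 * u\<^sup>2 * (u - 1 / 3) \<le> 2 * R\<^sup>2 * (u - 1 / 3)"
      using u by (intro mult_right_mono mult_left_mono power_mono) auto
    moreover have "2 * u\<^sup>2 * (u - 1 / 3) - 2 * u ^ 3 + 2 * u\<^sup>2 - u + 1 / 5 = u * (4 / 3 * u - 1) + 1 / 5"
      by (simp add: power2_eq_square power3_eq_cube field_simps)
    moreover have "u * (4 / 3 * u - 1) \<ge> 0" using u by simp
    ultimately show "(R\<^sup>2 - u\<^sup>2)\<^sup>2 \<le> ?H u - ?H (u - 1)" by linarith
  qed auto
  then show ?thesis by (simp add: eval_nat_numeral algebra_simps)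
qed

text \<open>
  The volume of the paraboloid is \<open>\<pi> R\<^sup>4 / 2\<close>, where \<open>\<pi> / 2 = 1.5707...\<close>; the estimate of \<open>sqrt z\<close> by a
  linear function of \<open>z\<close> costs about one per cent and keeps all sums polynomial.
\<close>

lemma sum_paraboloid_le:
  fixes a b R :: real and T :: "(int \<times> int) set"
  assumes fin: "finite T" and R: "R \<ge> 1"
  shows "(\<Sum>p\<in>T. R\<^sup>2 - (fst p - a)\<^sup>2 - (snd p - b)\<^sup>2) \<le> 7951 / 5000 * R ^ 4 + 10 * R ^ 3"
proof -
  let ?X = "\<lambda>y. {x. (x, y) \<in> T}"
  define z where "z y = R\<^sup>2 - (real_of_int y - b)\<^sup>2" for y
  define Y where "Y = {y \<in> snd ` T. \<bar>y - b\<bar> \<le> R}"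
  have finX: "finite (?X y)" for y
    by (rule finite_subset[of _ "fst ` T"]) (use fin in force)+
  have finY: "finite Y" using fin by (simp add: Y_def)
  have eq: "T = prod.swap ` (SIGMA y:snd ` T. ?X y)"
    by (force simp: image_iff)
  have "(\<Sum>p\<in>T. R\<^sup>2 - (fst p - a)\<^sup>2 - (snd p - b)\<^sup>2) = (\<Sum>y\<in>snd ` T. \<Sum>x\<in>?X y. z y - (x - a)\<^sup>2)"
  proof -
    have "(\<Sum>p\<in>T. R\<^sup>2 - (fst p - a)\<^sup>2 - (snd p - b)\<^sup>2)
      = (\<Sum>q\<in>(SIGMA y:snd ` T. ?X y). R\<^sup>2 - (snd q - a)\<^sup>2 - (fst q - b)\<^sup>2)"
      by (subst eq, subst sum.reindex) (auto simp: inj_on_def)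
    also have "\<dots> = (\<Sum>y\<in>snd ` T. \<Sum>x\<in>?X y. z y - (x - a)\<^sup>2)"
      using fin finX by (subst sum.Sigma) (auto simp: z_def algebra_simps intro!: sum.cong)
    finally show ?thesis .
  qed
  also have "\<dots> \<le> (\<Sum>y\<in>Y. \<Sum>x\<in>?X y. z y - (x - a)\<^sup>2)"
  proof -
    \<comment> \<open>Rows at distance at least \<open>R\<close> from the centre contribute nothing
      positive.\<close>
    have "(\<Sum>x\<in>?X y. z y - (x - a)\<^sup>2) \<le> 0" if "y \<in> snd ` T - Y" for y
    proof (rule sum_nonpos)
      fix x :: int
      have "R \<le> \<bar>y - b\<bar>" using that by (auto simp: Y_def)
      then have "R\<^sup>2 \<le> (y - b)\<^sup>2" using R by (metis abs_le_square_iff abs_of_nonneg order_trans zero_le_one)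
      then show "z y - (x - a)\<^sup>2 \<le> 0" using zero_le_power2[of "x - a"] unfolding z_def by linarith
    qed
    then have "(\<Sum>y\<in>snd ` T - Y. \<Sum>x\<in>?X y. z y - (x - a)\<^sup>2) \<le> 0" by (rule sum_nonpos)
    moreover have "(\<Sum>y\<in>snd ` T. \<Sum>x\<in>?X y. z y - (x - a)\<^sup>2) = (\<Sum>y\<in>snd ` T - Y. \<Sum>x\<in>?X y. z y - (x - a)\<^sup>2)
        + (\<Sum>y\<in>Y. \<Sum>x\<in>?X y. z y - (x - a)\<^sup>2)"
      using fin by (intro sum.subset_diff) (auto simp: Y_def)
    ultimately show ?thesis by linarith
  qed
  also have "\<dots> \<le> (\<Sum>y\<in>Y. 2 / 3 * ((z y)\<^sup>2 / (9 / 10 * R) + 9 / 10 * R * z y) + 2 * z y)"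
  proof (rule sum_mono)
    fix y assume y: "y \<in> Y"
    then have "(y - b)\<^sup>2 \<le> R\<^sup>2" using R by (intro abs_le_square_iff[THEN iffD1]) (auto simp: Y_def)
    then have z0: "z y \<ge> 0" by (simp add: z_def)
    define \<rho> where "\<rho> = sqrt (z y)"
    have \<rho>: "\<rho> \<ge> 0" "\<rho>\<^sup>2 = z y" using z0 by (simp_all add: \<rho>_def)
    let ?X' = "{x \<in> ?X y. \<bar>x - a\<bar> \<le> \<rho>}"
    have "(\<Sum>x\<in>?X y. z y - (x - a)\<^sup>2) = (\<Sum>x\<in>?X y - ?X'. z y - (x - a)\<^sup>2) + (\<Sum>x\<in>?X'. z y - (x - a)\<^sup>2)"
      using finX by (intro sum.subset_diff) auto
    moreover have "(\<Sum>x\<in>?X y - ?X'. z y - (x - a)\<^sup>2) \<le> 0"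
    proof (rule sum_nonpos)
      fix x assume "x \<in> ?X y - ?X'"
      then have "\<bar>\<rho>\<bar> \<le> \<bar>x - a\<bar>" using \<rho>(1) by auto
      then show "z y - (x - a)\<^sup>2 \<le> 0" unfolding \<rho>(2)[symmetric] abs_le_square_iff by simp
    qed
    moreover have "(\<Sum>x\<in>?X'. z y - (x - a)\<^sup>2) \<le> 4 / 3 * \<rho> ^ 3 + 2 * \<rho>\<^sup>2"
      unfolding \<rho>(2)[symmetric] by (rule sum_parabola_le) (use finX \<rho> in auto)
    moreover have "4 / 3 * \<rho> ^ 3 \<le> 2 / 3 * ((z y)\<^sup>2 / (9 / 10 * R) + 9 / 10 * R * z y)"
    proof -
      \<comment> \<open>The inequality of the means, with equality at
        \<open>\<rho> = 9 / 10 * R\<close>, turns the cube of \<rho> into a polynomial in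
        \<open>z y\<close>. The factor 9/10 approximates \<open>sqrt (4 / 5)\<close>, which would
        minimise the leading coefficient.\<close>
      have "2 * \<rho> * (9 / 10 * R) \<le> \<rho>\<^sup>2 + (9 / 10 * R)\<^sup>2" by (rule sum_squares_bound)
      then have "2 * \<rho> \<le> \<rho>\<^sup>2 / (9 / 10 * R) + 9 / 10 * R"
        using R by (simp add: field_simps power2_eq_square)
      then have "2 / 3 * \<rho>\<^sup>2 * (2 * \<rho>) \<le> 2 / 3 * \<rho>\<^sup>2 * (\<rho>\<^sup>2 / (9 / 10 * R) + 9 / 10 * R)"
        by (intro mult_left_mono) auto
      also have "\<dots> = 2 / 3 * ((z y)\<^sup>2 / (9 / 10 * R) + 9 / 10 * R * z y)"
        unfolding \<rho>(2) by (simp add: algebra_simps power2_eq_square)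
      finally show ?thesis by (simp add: power2_eq_square power3_eq_cube)
    qed
    ultimately show "(\<Sum>x\<in>?X y. z y - (x - a)\<^sup>2) \<le> 2 / 3 * ((z y)\<^sup>2 / (9 / 10 * R) + 9 / 10 * R * z y) + 2 * z y"
      unfolding \<rho>(2) by linarith
  qed
  also have "\<dots> = 2 / 3 * ((\<Sum>y\<in>Y. (z y)\<^sup>2) / (9 / 10 * R)) + (3 / 5 * R + 2) * (\<Sum>y\<in>Y. z y)"
  proof -
    have "(\<Sum>y\<in>Y. 2 / 3 * ((z y)\<^sup>2 / (9 / 10 * R) + 9 / 10 * R * z y) + 2 * z y)
      = (\<Sum>y\<in>Y. 2 / 3 / (9 / 10 * R) * (z y)\<^sup>2 + (3 / 5 * R + 2) * z y)"
      by (rule sum.cong) (simp_all add: algebra_simps)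
    also have "\<dots> = 2 / 3 / (9 / 10 * R) * (\<Sum>y\<in>Y. (z y)\<^sup>2) + (3 / 5 * R + 2) * (\<Sum>y\<in>Y. z y)"
      by (simp only: sum.distrib sum_distrib_left)
    finally show ?thesis by simp
  qed
  also have "\<dots> \<le> 2 / 3 * ((16 / 15 * R ^ 5 + 2 * R ^ 4) / (9 / 10 * R)) + (3 / 5 * R + 2) * (4 / 3 * R ^ 3 + 2 * R\<^sup>2)"
    unfolding z_def
    by (intro add_mono mult_left_mono divide_right_mono sum_parabola_squares_le sum_parabola_le)
      (use R finY in \<open>auto simp: Y_def\<close>)
  \<comment> \<open>The leading coefficient is \<open>64 / 81 + 4 / 5 = 1.59012...\<close>; the
    remaining terms sum to less than \<open>10 * R ^ 3\<close>.\<close>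
  also have "\<dots> \<le> 7951 / 5000 * R ^ 4 + 10 * R ^ 3"
  proof -
    have "2 / 3 * ((16 / 15 * R ^ 5 + 2 * R ^ 4) / (9 / 10 * R)) = 64 / 81 * R ^ 4 + 40 / 27 * R ^ 3"
      using R by (simp add: field_simps eval_nat_numeral)
    moreover have "(3 / 5 * R + 2) * (4 / 3 * R ^ 3 + 2 * R\<^sup>2) = 4 / 5 * R ^ 4 + 58 / 15 * R ^ 3 + 4 * R\<^sup>2"
      by (simp add: field_simps eval_nat_numeral)
    moreover have "R\<^sup>2 \<le> R ^ 3" using R by (intro power_increasing) auto
    moreover have "R ^ 4 \<ge> 0" "R ^ 3 \<ge> 0" using R by auto
    ultimately show ?thesis by linarith
  qed
  finally show ?thesis .
qed

section \<open>The upper bound\<close>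

text \<open>
  Here \<open>Q\<close> bounds the squared norms, \<open>nI\<close> and \<open>nJ\<close> are the sizes of the two parts, \<open>EI\<close> and \<open>EJ\<close> their
  sums of squared norms, \<open>D\<close> the sum of each part along the main direction, and \<open>2 * a * D\<close> and \<open>2 * b * D\<close> their total
  absolute components across it.  If \<open>b\<close> is large then the second part has many vectors, which compensates
  the large variance caused by it.
\<close>

lemma cost_bound_unbalanced:
  fixes Q r D a b nI nJ EI EJ :: real
  assumes r: "r \<ge> 0" "r\<^sup>2 = Q" and D: "D \<ge> 0" and ab: "a \<ge> 0" "b > 3 / 5" "a + b \<le> 1"
    and EI: "0 \<le> EI" "EI \<le> nI * Q" "EI \<le> r * D * (1 + 2 * a)" and EJ: "EJ \<le> nJ * Q"
    and nJ: "nJ * r \<ge> 2 * b * D"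
  shows "(EI + EJ) / 4 + (nI + nJ) * Q / 4 + Q * (nI * b + nJ * a) / 6 \<le> 3 / 5 * Q * (nI + nJ)"
proof -
  \<comment> \<open>\<open>EI / 4\<close> is split: the share \<open>7 / 20 - b / 6\<close> is
    bounded through the number of vectors, the rest \<open>(b - 3 / 5) / 6\<close> through the bound
    by \<open>D\<close>.\<close>
  have "EI * (7 / 20 - b / 6) \<le> nI * Q * (7 / 20 - b / 6)"
    using EI ab by (intro mult_right_mono) auto
  then have 1: "EI / 4 + nI * Q * (b / 6 - 7 / 20) \<le> EI * (b - 3 / 5) / 6"
    by (simp add: field_simps)
  have 2: "EI * (b - 3 / 5) \<le> r * D * (1 + 2 * a) * (b - 3 / 5)"
    using EI ab by (intro mult_right_mono) auto
  have "r * D * ((1 + 2 * a) * (b - 3 / 5)) \<le> r * D * (2 * b * (3 / 5 - a))"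
  proof (rule mult_left_mono)
    \<comment> \<open>The extreme case is \<open>a = 1 - b\<close>.\<close>
    have "(1 + 2 * a) * (b - 3 / 5) \<le> (1 + 2 * (1 - b)) * (b - 3 / 5)"
      using ab by (intro mult_right_mono) auto
    also have "\<dots> \<le> 2 * b * (3 / 5 - (1 - b))"
      \<comment> \<open>The claim amounts to \<open>4 * b\<^sup>2 - 5 * b + 9 / 5 \<ge> 0\<close>,
        and the left side exceeds this square.\<close>
      using zero_le_power2[of "2 * b - 5 / 4"] by (simp add: power2_eq_square field_simps)
    also have "\<dots> \<le> 2 * b * (3 / 5 - a)" using ab by (intro mult_left_mono) auto
    finally show "(1 + 2 * a) * (b - 3 / 5) \<le> 2 * b * (3 / 5 - a)" .
  qed (use r D in simp)
  also have "\<dots> = (2 * b * D) * (r * (3 / 5 - a))" by simp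
  also have "\<dots> \<le> nJ * r * (r * (3 / 5 - a))"
    using nJ r ab by (intro mult_right_mono) auto
  also have "\<dots> = nJ * Q * (3 / 5 - a)" using r(2) by (simp add: power2_eq_square)
  finally have 3: "r * D * (1 + 2 * a) * (b - 3 / 5) \<le> nJ * Q * (3 / 5 - a)" by simp
  have "(EI + EJ) / 4 + (nI + nJ) * Q / 4 + Q * (nI * b + nJ * a) / 6 - 3 / 5 * Q * (nI + nJ)
      = (EI / 4 + nI * Q * (b / 6 - 7 / 20)) + EJ / 4 - nJ * Q / 4 - nJ * Q * (3 / 5 - a) / 6"
    by (simp add: field_simps)
  then show ?thesis using 1 2 3 EJ by argo
qed

text \<open>If \<open>a\<close> and \<open>b\<close> are at most 3/5, the trivial bounds suffice, as
  \<open>1 / 4 + 1 / 4 + (3 / 5) / 6 = 3 / 5\<close>. Otherwise exactly one exceeds 3/5, and by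
  symmetry the unbalanced estimate applies.\<close>

lemma cost_bound:
  fixes Q r D a b nI nJ EI EJ :: real
  assumes r: "r \<ge> 0" "r\<^sup>2 = Q" and D: "D \<ge> 0" and ab: "a \<ge> 0" "b \<ge> 0" "a + b \<le> 1"
    and EI: "0 \<le> EI" "EI \<le> nI * Q" "EI \<le> r * D * (1 + 2 * a)"
    and EJ: "0 \<le> EJ" "EJ \<le> nJ * Q" "EJ \<le> r * D * (1 + 2 * b)"
    and n: "nI \<ge> 0" "nJ \<ge> 0" "nI * r \<ge> 2 * a * D" "nJ * r \<ge> 2 * b * D"
  shows "(EI + EJ) / 4 + (nI + nJ) * Q / 4 + Q * (nI * b + nJ * a) / 6 \<le> 3 / 5 * Q * (nI + nJ)"
proof -
  consider "b > 3 / 5" | "a > 3 / 5" | "a \<le> 3 / 5" "b \<le> 3 / 5" by linarith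
  then show ?thesis
  proof cases
    case 1
    then show ?thesis using cost_bound_unbalanced[OF r D ab(1) 1 ab(3) EI EJ(2) n(4)] by simp
  next
    case 2
    have "b + a \<le> 1" using ab by simp
    from cost_bound_unbalanced[OF r D ab(2) 2 this EJ EI(2) n(3)] show ?thesis
      by (simp add: add.commute)
  next
    case 3
    have "nI * b + nJ * a \<le> nI * (3 / 5) + nJ * (3 / 5)"
      using 3 n by (intro add_mono mult_left_mono) auto
    then have "Q * (nI * b + nJ * a) \<le> Q * (nI * (3 / 5) + nJ * (3 / 5))"
      using r by (intro mult_left_mono) auto
    then show ?thesis using EI(2) EJ(2) by (simp add: field_simps)
  qed
qed

section \<open>Distinct partial sums close to a common centre\<close>

lemma exists_max_subset:
  fixes h :: "'a set \<Rightarrow> 'b::linorder"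
  assumes "finite S"
  obtains I where "I \<subseteq> S" "\<And>T. T \<subseteq> S \<Longrightarrow> h T \<le> h I"
proof -
  have "finite (h ` Pow S)" "h ` Pow S \<noteq> {}" using assms by auto
  then have "Max (h ` Pow S) \<in> h ` Pow S" by (rule Max_in)
  then obtain I where "I \<subseteq> S" "h I = Max (h ` Pow S)" by auto
  then show thesis using assms by (intro that[of I]) auto
qed

text \<open>Two equal partial sums would differ by a nonempty proper zero-sum subset, so any order
  yields as many lattice points as there are vectors; a cheap order puts them close to a
  centre.\<close>

lemma exists_small_sums:
  fixes x y :: "'a \<Rightarrow> int" and q :: real
  assumes fin: "finite S" and zero: "sum x S = 0" "sum y S = 0"
    and min: "\<And>T. T \<noteq> {} \<Longrightarrow> T \<subset> S \<Longrightarrow> (sum x T, sum y T) \<noteq> (0, 0)"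
    and card: "card S \<ge> 2"
    and q: "\<And>v. v \<in> S \<Longrightarrow> (real_of_int (x v))\<^sup>2 + (real_of_int (y v))\<^sup>2 \<le> q"
  obtains P :: "(int \<times> int) set" and a b :: real where "finite P" "card P = card S"
    "(\<Sum>p\<in>P. (fst p - a)\<^sup>2 + (snd p - b)\<^sup>2) \<le> 3 / 5 * q * card S"
proof -
  note result = that
  obtain I where I: "I \<subseteq> S" and max: "\<And>T. T \<subseteq> S \<Longrightarrow> (sum x T)\<^sup>2 + (sum y T)\<^sup>2 \<le> (sum x I)\<^sup>2 + (sum y I)\<^sup>2"
    using exists_max_subset[OF fin, of "\<lambda>T. (sum x T)\<^sup>2 + (sum y T)\<^sup>2"] by blast
  define J where "J = S - I"
  define X Y where "X = sum x I" and "Y = sum y I"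
  define F where "F = nat (X\<^sup>2 + Y\<^sup>2)"
  \<comment> \<open>Inner product and determinant with the longest sum \<open>(X, Y)\<close>: the
    components along and across it, kept integral by a scaling that multiplies squared lengths by
    \<open>F\<close>.\<close>
  define f where "f v = x v * X + y v * Y" for v
  define g where "g v = X * y v - Y * x v" for v
  have S: "S = I \<union> J" "I \<inter> J = {}" "finite I" "finite J" using I fin by (auto simp: J_def intro: finite_subset)
  have J: "J \<subseteq> S" by (auto simp: J_def)
  have nz: "(x v)\<^sup>2 + (y v)\<^sup>2 > 0" if "v \<in> S" for v
  proof -
    have "{v} \<noteq> S" using card by auto
    then have "x v \<noteq> 0 \<or> y v \<noteq> 0" using min[of "{v}"] that by auto
    then show ?thesis by (simp add: sum_power2_gt_zero_iff)
  qed
  have F: "int F = X\<^sup>2 + Y\<^sup>2" by (simp add: F_def)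
  have F0: "F > 0"
  proof -
    obtain v where v: "v \<in> S" using card by fastforce
    then have "(x v)\<^sup>2 + (y v)\<^sup>2 \<le> int F" using max[of "{v}"] by (simp add: F X_def Y_def)
    then show ?thesis using nz[OF v] by simp
  qed
  \<comment> \<open>Otherwise dropping the nonzero vector \<open>v\<close> would lengthen the sum;
    for \<open>J\<close>, adding it would.\<close>
  have fI: "f v > 0" if v: "v \<in> I" for v
  proof -
    have "sum x (I - {v}) = X - x v" "sum y (I - {v}) = Y - y v"
      using v S(3) by (simp_all add: X_def Y_def sum_diff1)
    then have "(X - x v)\<^sup>2 + (Y - y v)\<^sup>2 \<le> X\<^sup>2 + Y\<^sup>2"
      using max[of "I - {v}"] I by (auto simp: X_def Y_def)
    moreover have "(X - x v)\<^sup>2 + (Y - y v)\<^sup>2 = X\<^sup>2 + Y\<^sup>2 - 2 * f v + ((x v)\<^sup>2 + (y v)\<^sup>2)"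
      by (simp add: f_def power2_eq_square algebra_simps)
    ultimately show ?thesis using nz[of v] v I by auto
  qed
  have fJ: "f v < 0" if v: "v \<in> J" for v
  proof -
    have "v \<notin> I" using v by (simp add: J_def)
    then have "sum x (insert v I) = X + x v" "sum y (insert v I) = Y + y v"
      using S(3) by (simp_all add: X_def Y_def)
    then have "(X + x v)\<^sup>2 + (Y + y v)\<^sup>2 \<le> X\<^sup>2 + Y\<^sup>2"
      using max[of "insert v I"] I v by (auto simp: X_def Y_def J_def)
    moreover have "(X + x v)\<^sup>2 + (Y + y v)\<^sup>2 = X\<^sup>2 + Y\<^sup>2 + 2 * f v + ((x v)\<^sup>2 + (y v)\<^sup>2)"
      by (simp add: f_def power2_eq_square algebra_simps)
    ultimately show ?thesis using nz[of v] v by (auto simp: J_def)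
  qed
  have sumf: "sum f T = X * sum x T + Y * sum y T" for T
    by (simp add: f_def sum.distrib sum_distrib_left mult.commute)
  have sumg: "sum g T = X * sum y T - Y * sum x T" for T
    by (simp add: g_def sum_subtractf sum_distrib_left)
  have xyJ: "sum x J = - X" "sum y J = - Y"
    using zero S by (simp_all add: X_def Y_def sum.union_disjoint)
  have sums: "sum f I = int F" "sum f J = - int F" "sum g I = 0" "sum g J = 0"
    unfolding sumf sumg xyJ F by (simp_all flip: X_def Y_def add: power2_eq_square)
  have pyth: "(real_of_int (f v))\<^sup>2 + (real_of_int (g v))\<^sup>2 = F * ((real_of_int (x v))\<^sup>2 + (real_of_int (y v))\<^sup>2)" for v
  proof -
    have "(f v)\<^sup>2 + (g v)\<^sup>2 = int F * ((x v)\<^sup>2 + (y v)\<^sup>2)"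
      unfolding f_def g_def F by algebra
    then have "real_of_int ((f v)\<^sup>2 + (g v)\<^sup>2) = real_of_int (int F * ((x v)\<^sup>2 + (y v)\<^sup>2))" by simp
    then show ?thesis by simp
  qed
  define Q where "Q = F * q"
  have Q: "(real_of_int (f v))\<^sup>2 + (real_of_int (g v))\<^sup>2 \<le> Q" if "v \<in> S" for v
    unfolding pyth Q_def by (intro mult_left_mono q that) simp
  have Q': "(real_of_int (f v))\<^sup>2 + (real_of_int (g v))\<^sup>2 \<le> Q" if "v \<in> I \<union> J" for v
    using Q that S(1) by simp
  have Q0: "Q \<ge> 0"
  proof -
    obtain v where v: "v \<in> S" using card by fastforce
    then show ?thesis using Q[OF v] sum_power2_ge_zero[of "real_of_int (f v)" "real_of_int (g v)"] by linarith
  qed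
  define r where "r = sqrt Q"
  have r: "r \<ge> 0" "r\<^sup>2 = Q" using Q0 by (simp_all add: r_def)
  define E where "E T = (\<Sum>v\<in>T. (real_of_int (f v))\<^sup>2 + (real_of_int (g v))\<^sup>2)" for T
  define G where "G T = (\<Sum>v\<in>T. \<bar>real_of_int (g v)\<bar>)" for T
  define \<Phi> where "\<Phi> T = (\<Sum>u\<in>T. \<bar>real_of_int (f u)\<bar> * (real_of_int (g u))\<^sup>2)" for T
  have gr: "\<bar>real_of_int (g v)\<bar> \<le> r" if "v \<in> S" for v
    unfolding r_def by (rule real_le_rsqrt) (use Q[OF that] zero_le_power2[of "real_of_int (f v)"] in \<open>simp, linarith\<close>)
  have EQ: "0 \<le> E T" "E T \<le> card T * Q" if "T \<subseteq> S" for T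
    unfolding E_def using that Q by (auto intro!: sum_nonneg sum_bounded_above)
  have Gr: "0 \<le> G T" "G T \<le> card T * r" if "T \<subseteq> S" for T
    unfolding G_def using that gr by (auto intro!: sum_nonneg sum_bounded_above)
  have Er: "E T \<le> r * ((\<Sum>v\<in>T. \<bar>real_of_int (f v)\<bar>) + G T)" if "T \<subseteq> S" for T
    unfolding E_def G_def sum.distrib[symmetric] sum_distrib_left
  proof (rule sum_mono)
    fix v assume "v \<in> T"
    then have v: "v \<in> S" using that by auto
    let ?e = "(real_of_int (f v))\<^sup>2 + (real_of_int (g v))\<^sup>2"
    have "sqrt ?e \<le> \<bar>real_of_int (f v)\<bar> + \<bar>real_of_int (g v)\<bar>" by (rule sqrt_sum_squares_le_sum_abs)
    moreover have "sqrt ?e \<le> r" unfolding r_def using Q[OF v] by simp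
    ultimately have "sqrt ?e * sqrt ?e \<le> r * (\<bar>real_of_int (f v)\<bar> + \<bar>real_of_int (g v)\<bar>)"
      using r(1) by (intro mult_mono) auto
    then show "?e \<le> r * (\<bar>real_of_int (f v)\<bar> + \<bar>real_of_int (g v)\<bar>)" by simp
  qed
  have \<Phi>G: "\<Phi> T \<le> Q / 2 * G T" if "T \<subseteq> S" for T
    unfolding \<Phi>_def G_def sum_distrib_left
  proof (rule sum_mono)
    fix v assume "v \<in> T"
    then have v: "v \<in> S" using that by auto
    have "2 * \<bar>real_of_int (f v)\<bar> * \<bar>real_of_int (g v)\<bar> \<le> \<bar>real_of_int (f v)\<bar>\<^sup>2 + \<bar>real_of_int (g v)\<bar>\<^sup>2"
      by (rule sum_squares_bound)
    then have "\<bar>real_of_int (f v)\<bar> * \<bar>real_of_int (g v)\<bar> \<le> Q / 2" using Q[OF v] by simp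
    then have "\<bar>real_of_int (f v)\<bar> * \<bar>real_of_int (g v)\<bar> * \<bar>real_of_int (g v)\<bar> \<le> Q / 2 * \<bar>real_of_int (g v)\<bar>"
      by (rule mult_right_mono) simp
    then show "\<bar>real_of_int (f v)\<bar> * (real_of_int (g v))\<^sup>2 \<le> Q / 2 * \<bar>real_of_int (g v)\<bar>"
      by (simp add: power2_eq_square mult.assoc flip: abs_mult)
  qed
  have absf: "(\<Sum>v\<in>I. \<bar>real_of_int (f v)\<bar>) = F" "(\<Sum>v\<in>J. \<bar>real_of_int (f v)\<bar>) = F"
  proof -
    have "(\<Sum>v\<in>I. \<bar>real_of_int (f v)\<bar>) = real_of_int (sum f I)" using fI by (simp add: less_imp_le)
    then show "(\<Sum>v\<in>I. \<bar>real_of_int (f v)\<bar>) = F" using sums(1) by simp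
    have "(\<Sum>v\<in>J. \<bar>real_of_int (f v)\<bar>) = (\<Sum>v\<in>J. - real_of_int (f v))"
      using fJ by (intro sum.cong) (auto simp: less_imp_le)
    also have "\<dots> = - real_of_int (sum f J)" by (simp add: sum_negf)
    finally show "(\<Sum>v\<in>J. \<bar>real_of_int (f v)\<bar>) = F" using sums(2) by simp
  qed
  \<comment> \<open>As \<open>g\<close> has total sum 0, half of the total of
    \<open>\<bar>g\<bar>\<close> is the sum of \<open>g\<close> over the vectors on one side. That
    is the scaled component of a subset sum, and no subset sum is longer than
    \<open>(X, Y)\<close>.\<close>
  have GIJ: "G I + G J \<le> 2 * F"
  proof -
    let ?T = "{v \<in> S. g v > 0}"
    have "G I + G J = G S" unfolding G_def S(1) using S by (simp add: sum.union_disjoint)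
    also have "\<dots> = G S + real_of_int (sum g S)"
      using S sums(3,4) by (simp add: sum.union_disjoint)
    also have "\<dots> = (\<Sum>v\<in>S. if g v > 0 then 2 * real_of_int (g v) else 0)"
      unfolding G_def of_int_sum sum.distrib[symmetric] by (intro sum.cong) auto
    also have "\<dots> = 2 * real_of_int (sum g ?T)"
      using fin by (simp add: sum.If_cases sum_distrib_left Int_def conj_commute)
    finally have GS: "G I + G J = 2 * real_of_int (sum g ?T)" .
    have "(sum g ?T)\<^sup>2 \<le> (X\<^sup>2 + Y\<^sup>2) * ((sum x ?T)\<^sup>2 + (sum y ?T)\<^sup>2)"
    proof -
      have "(X\<^sup>2 + Y\<^sup>2) * ((sum x ?T)\<^sup>2 + (sum y ?T)\<^sup>2) = (sum g ?T)\<^sup>2 + (sum f ?T)\<^sup>2"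
        unfolding sumg sumf by algebra
      then show ?thesis by simp
    qed
    also have "\<dots> \<le> (X\<^sup>2 + Y\<^sup>2) * (X\<^sup>2 + Y\<^sup>2)"
      using max[of ?T] by (intro mult_left_mono) (auto simp: X_def Y_def)
    also have "\<dots> = (int F)\<^sup>2" by (simp add: F power2_eq_square)
    finally have "sum g ?T \<le> int F" by (rule power2_le_imp_le) simp
    then have "real_of_int (sum g ?T) \<le> real F" by (metis of_int_le_iff of_int_of_nat_eq)
    then show ?thesis using GS by linarith
  qed
  obtain K :: "'a \<Rightarrow> nat" and cf cg :: real where K: "inj_on K S"
    and cost: "(\<Sum>v\<in>S. ((\<Sum>u\<in>before S K v. real_of_int (f u)) + f v / 2 - cf)\<^sup>2 +
        ((\<Sum>u\<in>before S K v. real_of_int (g u)) + g v / 2 - cg)\<^sup>2)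
      \<le> real (card I) * (Q / 4 + \<Phi> J / (6 * real F)) + real (card J) * (Q / 4 + \<Phi> I / (6 * real F))"
    unfolding \<Phi>_def
    by (rule exists_order[OF S(3,4,2) fI fJ sums(1,2) F0 sums(3,4) Q', folded S(1)]) (assumption | rule that)+
  define Bf where "Bf v = real_of_int (sum f (before S K v)) - cf" for v
  define Bg where "Bg v = real_of_int (sum g (before S K v)) - cg" for v
  \<comment> \<open>The parallelogram law passes from the midpoints of the steps to their two
    ends.\<close>
  have "(\<Sum>v\<in>S. (Bf v)\<^sup>2 + (Bg v)\<^sup>2) + (\<Sum>v\<in>S. (Bf v + f v)\<^sup>2 + (Bg v + g v)\<^sup>2)
      = 2 * (\<Sum>v\<in>S. (Bf v + f v / 2)\<^sup>2 + (Bg v + g v / 2)\<^sup>2) + E S / 2"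
    unfolding E_def sum_distrib_left sum_divide_distrib sum.distrib[symmetric]
    by (intro sum.cong) (auto simp: power2_eq_square field_simps)
  also have "(\<Sum>v\<in>S. (Bf v + f v / 2)\<^sup>2 + (Bg v + g v / 2)\<^sup>2)
     \<le> real (card I) * (Q / 4 + \<Phi> J / (6 * real F)) + real (card J) * (Q / 4 + \<Phi> I / (6 * real F))"
    using cost by (simp add: Bf_def Bg_def algebra_simps)
  also have "\<dots> \<le> real (card I) * (Q / 4 + Q / 2 * G J / (6 * real F)) + real (card J) * (Q / 4 + Q / 2 * G I / (6 * real F))"
    by (intro add_mono mult_left_mono divide_right_mono \<Phi>G I J) auto
  also have "E S = E I + E J" unfolding E_def S(1) using S by (simp add: sum.union_disjoint)
  finally have total: "(\<Sum>v\<in>S. (Bf v)\<^sup>2 + (Bg v)\<^sup>2) + (\<Sum>v\<in>S. (Bf v + f v)\<^sup>2 + (Bg v + g v)\<^sup>2)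
     \<le> 2 * (real (card I) * (Q / 4 + Q / 2 * G J / (6 * real F)) + real (card J) * (Q / 4 + Q / 2 * G I / (6 * real F)))
       + (E I + E J) / 2" by simp
  define a b where "a = G I / (2 * F)" and "b = G J / (2 * F)"
  have Gab: "G I = 2 * a * F" "G J = 2 * b * F" using F0 by (simp_all add: a_def b_def)
  have cardS: "real (card S) = real (card I) + real (card J)" using S by (simp add: card_Un_disjoint)
  have main: "(E I + E J) / 4 + (real (card I) + real (card J)) * Q / 4 + Q * (real (card I) * b + real (card J) * a) / 6
     \<le> 3 / 5 * Q * (real (card I) + real (card J))"
  proof (rule cost_bound[OF r, where D = "real F"])
    show "a \<ge> 0" "b \<ge> 0" using Gr(1)[OF I] Gr(1)[OF J] by (simp_all add: a_def b_def)
    show "a + b \<le> 1" using GIJ F0 by (simp add: a_def b_def field_simps)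
    show "E I \<le> r * real F * (1 + 2 * a)" using Er[OF I] unfolding absf Gab by (simp add: algebra_simps)
    show "E J \<le> r * real F * (1 + 2 * b)" using Er[OF J] unfolding absf Gab by (simp add: algebra_simps)
    show "2 * a * real F \<le> real (card I) * r" "2 * b * real F \<le> real (card J) * r"
      using Gr(2)[OF I] Gr(2)[OF J] by (simp_all add: Gab)
  qed (use EQ[OF I] EQ[OF J] in auto)
  have eq: "2 * (real (card I) * (Q / 4 + Q / 2 * G J / (6 * real F)) + real (card J) * (Q / 4 + Q / 2 * G I / (6 * real F)))
       + (E I + E J) / 2
     = 2 * ((E I + E J) / 4 + (real (card I) + real (card J)) * Q / 4 + Q * (real (card I) * b + real (card J) * a) / 6)"
    using F0 unfolding Gab by (simp add: field_simps)
  have two: "(\<Sum>v\<in>S. (Bf v)\<^sup>2 + (Bg v)\<^sup>2) + (\<Sum>v\<in>S. (Bf v + f v)\<^sup>2 + (Bg v + g v)\<^sup>2)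
     \<le> 2 * (3 / 5 * Q * real (card S))"
    using order_trans[OF total[unfolded eq] mult_left_mono[OF main, of 2]] unfolding cardS by simp
  \<comment> \<open>The centre carried back to the original coordinates by the inverse
    similarity.\<close>
  define ca cb where "ca = (X * cf - Y * cg) / F" and "cb = (Y * cf + X * cg) / F"
  have Freal: "real F = (real_of_int X)\<^sup>2 + (real_of_int Y)\<^sup>2"
    using arg_cong[OF F, of real_of_int] by simp
  have conv: "(real_of_int (sum f T) - cf)\<^sup>2 + (real_of_int (sum g T) - cg)\<^sup>2
     = F * ((sum x T - ca)\<^sup>2 + (sum y T - cb)\<^sup>2)" for T
  proof -
    have c: "cf = X * ca + Y * cb" "cg = X * cb - Y * ca"
      using F0 unfolding ca_def cb_def Freal[symmetric]
      by (simp_all add: field_simps) (simp_all add: Freal power2_eq_square algebra_simps)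
    show ?thesis unfolding sumf sumg c Freal
      by (simp add: power2_eq_square algebra_simps)
  qed
  have finish: thesis
    if D: "\<And>v. v \<in> S \<Longrightarrow> D v \<subseteq> S"
      and strict: "\<And>u v. u \<in> S \<Longrightarrow> v \<in> S \<Longrightarrow> K u < K v \<Longrightarrow> D u \<subset> D v \<and> D v - D u \<noteq> S"
      and le: "(\<Sum>v\<in>S. (real_of_int (sum f (D v)) - cf)\<^sup>2 + (real_of_int (sum g (D v)) - cg)\<^sup>2) \<le> 3 / 5 * Q * card S"
    for D
  proof -
    let ?p = "\<lambda>v. (sum x (D v), sum y (D v))"
    have ne: "?p u \<noteq> ?p v" if uv: "u \<in> S" "v \<in> S" "K u < K v" for u v
    proof
      assume eq: "?p u = ?p v"
      have "D u \<subset> D v" "D v - D u \<noteq> S" using strict[OF uv] by auto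
      then have "D v - D u \<noteq> {}" "D v - D u \<subset> S" using D[OF uv(2)] by auto
      from min[OF this] show False
        using eq \<open>D u \<subset> D v\<close> finite_subset[OF D[OF uv(2)] \<open>finite S\<close>] by (simp add: sum_diff less_imp_le)
    qed
    have inj: "inj_on ?p S"
    proof (rule inj_onI, rule ccontr)
      fix u v assume uv: "u \<in> S" "v \<in> S" "?p u = ?p v" "u \<noteq> v"
      then have "K u \<noteq> K v" using K by (auto dest: inj_onD)
      then show False using ne[of u v] ne[of v u] uv by (metis linorder_neqE_nat)
    qed
    have "F * (\<Sum>p\<in>?p ` S. (fst p - ca)\<^sup>2 + (snd p - cb)\<^sup>2) \<le> 3 / 5 * Q * card S"
      using le unfolding conv by (simp add: sum.reindex[OF inj] sum_distrib_left)
    then have "(\<Sum>p\<in>?p ` S. (fst p - ca)\<^sup>2 + (snd p - cb)\<^sup>2) \<le> 3 / 5 * q * card S"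
      using F0 by (simp add: Q_def mult.assoc mult.left_commute[of _ "real F"])
    then show thesis by (rule result[OF finite_imageI[OF fin] card_image[OF inj]])
  qed
  \<comment> \<open>The partial sums before and after each element have a controlled average, so one of the two families is small.\<close>
  consider "(\<Sum>v\<in>S. (Bf v)\<^sup>2 + (Bg v)\<^sup>2) \<le> 3 / 5 * Q * card S"
    | "(\<Sum>v\<in>S. (Bf v + f v)\<^sup>2 + (Bg v + g v)\<^sup>2) \<le> 3 / 5 * Q * card S"
    using two by linarith
  then show thesis
  proof cases
    case 1
    show thesis
    proof (rule finish[of "before S K"])
      show "(\<Sum>v\<in>S. (real_of_int (sum f (before S K v)) - cf)\<^sup>2 + (real_of_int (sum g (before S K v)) - cg)\<^sup>2) \<le> 3 / 5 * Q * card S"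
        using 1 by (simp add: Bf_def Bg_def)
      show "before S K u \<subset> before S K v \<and> before S K v - before S K u \<noteq> S" if "u \<in> S" "v \<in> S" "K u < K v" for u v
        using that by (auto simp: before_def)
    qed (simp add: before_subset)
  next
    case 2
    show thesis
    proof (rule finish[of "\<lambda>v. insert v (before S K v)"])
      have "sum h (insert v (before S K v)) = sum h (before S K v) + h v" for h :: "'a \<Rightarrow> int" and v
        using fin by simp
      then show "(\<Sum>v\<in>S. (real_of_int (sum f (insert v (before S K v))) - cf)\<^sup>2 +
          (real_of_int (sum g (insert v (before S K v))) - cg)\<^sup>2) \<le> 3 / 5 * Q * card S"
        using 2 by (simp add: Bf_def Bg_def algebra_simps)
      show "insert u (before S K u) \<subset> insert v (before S K v) \<and> insert v (before S K v) - insert u (before S K u) \<noteq> S"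
        if "u \<in> S" "v \<in> S" "K u < K v" for u v
        using that by (auto simp: before_def)
      show "insert v (before S K v) \<subseteq> S" if "v \<in> S" for v
        using that before_subset[of S K v] by simp
    qed
  qed
qed

section \<open>Passage to the Davenport constant\<close>

lemma davenport_le:
  assumes "\<And>xs. set xs \<subseteq> X \<Longrightarrow> minimal_zero_sum xs \<Longrightarrow> real (length xs) \<le> B"
  shows "ereal_of_enat (davenport X) \<le> ereal B"
proof -
  have "minimal_zero_sum ([] :: 'a list)" by (simp add: minimal_zero_sum_def)
  then have "B \<ge> 0" using assms[of "[]"] by simp
  have "davenport X \<le> enat (nat \<lfloor>B\<rfloor>)"
    unfolding davenport_def
  proof (rule SUP_least)
    fix xs assume "xs \<in> {xs. set xs \<subseteq> X \<and> minimal_zero_sum xs}"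
    then have "real (length xs) \<le> B" using assms by simp
    then have "length xs \<le> nat \<lfloor>B\<rfloor>" by (simp add: le_nat_iff le_floor_iff)
    then show "enat (length xs) \<le> enat (nat \<lfloor>B\<rfloor>)" by simp
  qed
  then have "ereal_of_enat (davenport X) \<le> ereal_of_enat (enat (nat \<lfloor>B\<rfloor>))"
    by (simp only: ereal_of_enat_le_iff)
  also have "\<dots> \<le> ereal B" using \<open>B \<ge> 0\<close> by simp
  finally show ?thesis .
qed

text \<open>Summing \<open>R\<^sup>2\<close> minus the squared distance over the lattice points
  gives at least \<open>length xs * (R\<^sup>2 - 6 / 5 * m\<^sup>2)\<close>, since the squared norms
  are at most \<open>2 * m\<^sup>2\<close>. The paraboloid estimate bounds the same sum from
  above.\<close>

lemma length_minimal_zero_sum_le: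
  assumes m: "m \<ge> 1" and xs: "set xs \<subseteq> {- int m..int m} \<times> {- int m..int m}" and min: "minimal_zero_sum xs"
  shows "real (length xs) \<le> 191 / 25 * (real m)\<^sup>2 + 31 * real m"
proof (cases "length xs \<ge> 2")
  case False
  then have "real (length xs) \<le> 1" "1 \<le> real m" using m by auto
  then show ?thesis using zero_le_power2[of "real m"] by linarith
next
  case True
  let ?S = "{..<length xs}"
  let ?x = "\<lambda>i. fst (xs ! i)" and ?y = "\<lambda>i. snd (xs ! i)"
  have sums: "(\<Sum>i\<in>T. xs ! i) = (sum ?x T, sum ?y T)" for T
    by (intro prod_eqI) (simp_all add: fst_sum snd_sum)
  have box: "(real_of_int (?x i))\<^sup>2 + (real_of_int (?y i))\<^sup>2 \<le> 2 * (real m)\<^sup>2" if "i \<in> ?S" for i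
  proof -
    have "xs ! i \<in> {- int m..int m} \<times> {- int m..int m}" using that xs by (auto simp: subset_eq)
    then have "\<bar>real_of_int (?x i)\<bar> \<le> \<bar>real m\<bar>" "\<bar>real_of_int (?y i)\<bar> \<le> \<bar>real m\<bar>"
      by (auto simp: mem_Times_iff abs_le_iff)
    then show ?thesis unfolding abs_le_square_iff by linarith
  qed
  obtain P :: "(int \<times> int) set" and a b :: real where P: "finite P" "card P = card ?S"
    "(\<Sum>p\<in>P. (fst p - a)\<^sup>2 + (snd p - b)\<^sup>2) \<le> 3 / 5 * (2 * (real m)\<^sup>2) * card ?S"
  proof (rule exists_small_sums[of ?S ?x ?y "2 * (real m)\<^sup>2"])
    have "(sum ?x ?S, sum ?y ?S) = (0, 0)"
      using min by (simp only: minimal_zero_sum_def sums zero_prod_def)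
    then show "sum ?x ?S = 0" "sum ?y ?S = 0" by simp_all
    show "(sum ?x T, sum ?y T) \<noteq> (0, 0)" if "T \<noteq> {}" "T \<subset> ?S" for T
      using min that unfolding minimal_zero_sum_def sums zero_prod_def by blast
    show "card ?S \<ge> 2" using True by simp
    show "(real_of_int (?x v))\<^sup>2 + (real_of_int (?y v))\<^sup>2 \<le> 2 * (real m)\<^sup>2" if "v \<in> ?S" for v
      by (rule box[OF that])
  qed (simp, rule that)
  \<comment> \<open>\<open>R\<^sup>4 / (R\<^sup>2 - 6/5 m\<^sup>2)\<close> is minimal for \<open>R\<^sup>2 = 12/5 m\<^sup>2\<close>\<close>
  define R where "R = 31 / 20 * real m"
  have R: "R \<ge> 1" using m by (simp add: R_def)
  have "length xs * R\<^sup>2 - (\<Sum>p\<in>P. (fst p - a)\<^sup>2 + (snd p - b)\<^sup>2) = (\<Sum>p\<in>P. R\<^sup>2 - (fst p - a)\<^sup>2 - (snd p - b)\<^sup>2)"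
    using P(2) by (simp add: sum_subtractf sum.distrib)
  also have "\<dots> \<le> 7951 / 5000 * R ^ 4 + 10 * R ^ 3"
    by (rule sum_paraboloid_le[OF P(1) R])
  finally have "length xs * R\<^sup>2 - 6 / 5 * (real m)\<^sup>2 * length xs \<le> 7951 / 5000 * R ^ 4 + 10 * R ^ 3"
    using P(3) by simp
  \<comment> \<open>Here \<open>481 / 400 = (31 / 20)\<^sup>2 - 6 / 5\<close>.\<close>
  then have "481 / 400 * real (length xs) * (real m)\<^sup>2 \<le> (7951 / 5000 * (31 / 20) ^ 4 * (real m)\<^sup>2 + 10 * (31 / 20) ^ 3 * real m) * (real m)\<^sup>2"
    by (simp add: R_def power_mult_distrib eval_nat_numeral algebra_simps)
  then have "481 / 400 * real (length xs) \<le> 7951 / 5000 * (31 / 20) ^ 4 * (real m)\<^sup>2 + 10 * (31 / 20) ^ 3 * real m"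
    using m by (simp only: mult_le_cancel_right_pos zero_less_power of_nat_0_less_iff)
  also have "\<dots> \<le> 481 / 400 * (191 / 25 * (real m)\<^sup>2 + 31 * real m)"
    unfolding distrib_left mult.assoc[symmetric] by (intro add_mono mult_right_mono) (simp_all add: power_divide)
  finally show ?thesis by simp
qed

theorem theorem5:
  shows "\<exists>C\<^sub>1 C\<^sub>2 :: real. \<forall>m::nat. m \<ge> 2 \<longrightarrow>
    ereal (4 * (real m)\<^sup>2 - C\<^sub>1 * ln (real m))
      \<le> ereal_of_enat (davenport ({- int m..int m} \<times> {- int m..int m})) \<and>
    ereal_of_enat (davenport ({- int m..int m} \<times> {- int m..int m}))
      \<le> ereal (5 * pi / 2 * (real m)\<^sup>2 + C\<^sub>2 * real m)"
proof -
  obtain C where C: "\<And>m. m \<ge> 2 \<Longrightarrow> real (least_coprime m) \<le> C * ln (real m)"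
    using least_coprime_le_ln by blast
  show ?thesis
  proof (rule exI[of _ C], rule exI[of _ 31], intro allI impI conjI)
    fix m :: nat assume m: "m \<ge> 2"
    let ?D = "davenport ({- int m..int m} \<times> {- int m..int m})"
    \<comment> \<open>Truncated subtraction of naturals can only enlarge the difference.\<close>
    have "4 * m\<^sup>2 \<le> (4 * m\<^sup>2 - least_coprime m) + least_coprime m" by simp
    then have "real (4 * m\<^sup>2) \<le> real (4 * m\<^sup>2 - least_coprime m) + real (least_coprime m)" by linarith
    then have "4 * (real m)\<^sup>2 - C * ln (real m) \<le> real (4 * m\<^sup>2 - least_coprime m)"
      using C[OF m] by simp
    then have "ereal (4 * (real m)\<^sup>2 - C * ln (real m)) \<le> ereal_of_enat (enat (4 * m\<^sup>2 - least_coprime m))"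
      by simp
    also have "\<dots> \<le> ereal_of_enat ?D"
      using davenport_box_ge[OF m] by (simp only: ereal_of_enat_le_iff)
    finally show "ereal (4 * (real m)\<^sup>2 - C * ln (real m)) \<le> ereal_of_enat ?D" .
    \<comment> \<open>Only \<open>pi \<ge> 3.056\<close> is required.\<close>
    have "191 / 25 * (real m)\<^sup>2 \<le> 5 * pi / 2 * (real m)\<^sup>2"
      using pi_approx(1) by (intro mult_right_mono) auto
    moreover have "real (length xs) \<le> 191 / 25 * (real m)\<^sup>2 + 31 * real m"
      if "set xs \<subseteq> {- int m..int m} \<times> {- int m..int m}" "minimal_zero_sum xs" for xs
      using length_minimal_zero_sum_le[OF _ that] m by simp
    ultimately show "ereal_of_enat ?D \<le> ereal (5 * pi / 2 * (real m)\<^sup>2 + 31 * real m)"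
      by (intro davenport_le) (smt (verit))
  qed
qed

end
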